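(* Let $\mathcal{X},\mathcal{Y}$ be finite alphabets, $P_X$ a distribution on $\mathcal{X}$ and $P_{Y|X}$ a channel from $\mathcal{X}$ to $\mathcal{Y}$, with $P_{XY}=P_XP_{Y|X}$ and output distribution $P_Y$. Assume the channel is non-degenerate, i.e. $P_{Y^n|X^n}\neq P_{Y^n}$. For any $R>I(P_X,P_{Y|X})$, let $M=\lceil \exp(nR)\rceil$ and let $P_{Y^n|\mathscr{C}_M^n}$ be the induced output distribution of the random i.i.d. codebook $\mathscr{C}_M^n$. Then \[ \lim_{n\to\infty}-\frac1n\log\mathbb{E}\left[\left\|P_{Y^n|\mathscr{C}_M^n}-P_{Y^n}\right\|_1\right] =\min_{Q_{XY}\in\mathcal{P}(\mathcal{X}\times\mathcal{Y})}\Big\{D(Q_{XY}\|P_{XY})+\tfrac12\big[R-D(Q_{XY}\|P_XQ_Y)\big]_+\Big\} =\max_{\lambda\in[1,2]}\Big\{\frac{\lambda-1}{\lambda}\big(R-I^{\mathsf{s}}_\lambda(P_X,P_{Y|X})\big)\Big\}, \] where $Q_Y$ denotes the $\mathcal{Y}$-marginal of $Q_{XY}$ and $[f]_+=\max\{0,f\}$.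
   Context: Logarithms and exponentials are to an arbitrary but common base. $P_{X^n}$, $P_{Y^n}$ are the i.i.d. extensions of $P_X$, $P_Y$, and $P_{Y^n|X^n}(y^n|x^n)=\prod_{i=1}^nP_{Y|X}(y_i|x_i)$ is the memoryless extension of the channel. The random i.i.d. codebook $\mathscr{C}_M^n=\{X_1^n,\dots,X_M^n\}$ consists of $M$ codewords drawn independently from $P_{X^n}$, and the induced output distribution is the random distribution $P_{Y^n|\mathscr{C}_M^n}(y^n)=\frac1M\sum_{j=1}^MP_{Y^n|X^n}(y^n|X_j^n)$. The total variation distance is $\|P-Q\|_1=\sum_{x}|P(x)-Q(x)|$ (no factor $1/2$). $D(\cdot\|\cdot)$ is relative entropy and $I(P_X,P_{Y|X})=D(P_{XY}\|P_XP_Y)$ is mutual information. Sibson's $\alpha$-mutual information of order $\lambda>0$, $\lambda\neq1$, is $I^{\mathsf{s}}_\lambda(P_X,P_{Y|X})=\frac{\lambda}{\lambda-1}\log\sum_{y\in\mathcal{Y}}\big(\sum_{x\in\mathcal{X}}P_X(x)P_{Y|X}^\lambda(y|x)\big)^{1/\lambda}$, and $I^{\mathsf{s}}_1=I(P_X,P_{Y|X})$ (so the objective in the maximization equals $0$ at $\lambda=1$).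
   Formalization: Non-degeneracy is required on the support of P_X: some x with P_X(x)>0 has P_{Y|X}(·|x)≠P_Y. If the channel differs from P_Y only at inputs of probability zero, the expected distance is 0 and the claimed equality fails. *)

theory Defs
  imports "HOL-Analysis.Analysis"
begin

(* All logarithms/exponentials are to a common base b > 1. *)

definition is_pmf :: "('a::finite \<Rightarrow> real) \<Rightarrow> bool" where
  "is_pmf p \<longleftrightarrow> (\<forall>a. 0 \<le> p a) \<and> sum p UNIV = 1"

definition is_channel :: "('x::finite \<Rightarrow> 'y::finite \<Rightarrow> real) \<Rightarrow> bool" where
  "is_channel W \<longleftrightarrow> (\<forall>x. is_pmf (W x))"

definition out_dist :: "('x::finite \<Rightarrow> real) \<Rightarrow> ('x \<Rightarrow> 'y \<Rightarrow> real) \<Rightarrow> 'y \<Rightarrow> real" where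
  "out_dist P W y = (\<Sum>x\<in>UNIV. P x * W x y)"

definition joint :: "('x \<Rightarrow> real) \<Rightarrow> ('x \<Rightarrow> 'y \<Rightarrow> real) \<Rightarrow> 'x \<times> 'y \<Rightarrow> real" where
  "joint P W = (\<lambda>(x, y). P x * W x y)"

definition marg_Y :: "('x::finite \<times> 'y \<Rightarrow> real) \<Rightarrow> 'y \<Rightarrow> real" where
  "marg_Y Q y = (\<Sum>x\<in>UNIV. Q (x, y))"

definition rel_ent :: "real \<Rightarrow> ('a::finite \<Rightarrow> real) \<Rightarrow> ('a \<Rightarrow> real) \<Rightarrow> ereal" where
  "rel_ent b Q P = (if \<exists>a. Q a > 0 \<and> P a = 0 then \<infinity>
     else ereal (\<Sum>a\<in>{a. Q a > 0}. Q a * log b (Q a / P a)))"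

(* I(P_X, P_{Y|X}) = D(P_XY || P_X P_Y)  (always finite) *)
definition mutual_info :: "real \<Rightarrow> ('x::finite \<Rightarrow> real) \<Rightarrow> ('x \<Rightarrow> 'y::finite \<Rightarrow> real) \<Rightarrow> real" where
  "mutual_info b P W = real_of_ereal (rel_ent b (joint P W) (\<lambda>(x, y). P x * out_dist P W y))"

definition sibson_mi :: "real \<Rightarrow> ('x::finite \<Rightarrow> real) \<Rightarrow> ('x \<Rightarrow> 'y::finite \<Rightarrow> real) \<Rightarrow> real \<Rightarrow> real" where
  "sibson_mi b P W l = (if l = 1 then mutual_info b P W
     else l / (l - 1) * log b (\<Sum>y\<in>UNIV. (\<Sum>x\<in>UNIV. P x * W x y powr l) powr (1 / l)))"

definition seqs :: "nat \<Rightarrow> (nat \<Rightarrow> 'a) set" where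
  "seqs n = PiE {..<n} (\<lambda>_. UNIV)"

definition iid :: "('a \<Rightarrow> real) \<Rightarrow> nat \<Rightarrow> (nat \<Rightarrow> 'a) \<Rightarrow> real" where
  "iid P n x = (\<Prod>i<n. P (x i))"

definition mem_chan :: "('x \<Rightarrow> 'y \<Rightarrow> real) \<Rightarrow> nat \<Rightarrow> (nat \<Rightarrow> 'x) \<Rightarrow> (nat \<Rightarrow> 'y) \<Rightarrow> real" where
  "mem_chan W n x y = (\<Prod>i<n. W (x i) (y i))"

definition codebook_output :: "('x \<Rightarrow> 'y \<Rightarrow> real) \<Rightarrow> nat \<Rightarrow> nat \<Rightarrow> (nat \<Rightarrow> nat \<Rightarrow> 'x) \<Rightarrow> (nat \<Rightarrow> 'y) \<Rightarrow> real" where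
  "codebook_output W n M c y = (1 / real M) * (\<Sum>j<M. mem_chan W n (c j) y)"

definition expected_tv :: "('x::finite \<Rightarrow> real) \<Rightarrow> ('x \<Rightarrow> 'y::finite \<Rightarrow> real) \<Rightarrow> nat \<Rightarrow> nat \<Rightarrow> real" where
  "expected_tv P W n M =
     (\<Sum>c\<in>PiE {..<M} (\<lambda>_. seqs n). (\<Prod>j<M. iid P n (c j)) *
        (\<Sum>y\<in>seqs n. \<bar>codebook_output W n M c y - iid (out_dist P W) n y\<bar>))"

definition soft_cov_obj :: "real \<Rightarrow> real \<Rightarrow> ('x::finite \<Rightarrow> real) \<Rightarrow> ('x \<Rightarrow> 'y::finite \<Rightarrow> real) \<Rightarrow> ('x \<times> 'y \<Rightarrow> real) \<Rightarrow> ereal" where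
  "soft_cov_obj b R P W Q = rel_ent b Q (joint P W)
     + ereal (1/2) * max 0 (ereal R - rel_ent b Q (\<lambda>(x, y). P x * marg_Y Q y))"

end

theory Submission
  imports Defs
begin

text \<open>
  Put \<open>s = 1 - 1/l\<close>. For fixed \<open>l\<close> the functional \<open>D(Q || P_XY) - s D(Q || P_X Q_Y)\<close> is minimised
  by the tilted law \<open>Q_l(x,y) \<propto> P(x) W(y|x)\<^sup>l B(y)\<^bsup>1/l-1\<^esup>\<close> with \<open>B(y) = \<Sum>\<^sub>x P(x) W(y|x)\<^sup>l\<close>, and the
  minimum is \<open>- s I_l\<close>, where \<open>I_l\<close> is Sibson's information. Hence the maximum over \<open>l\<close> is at most the
  minimum over \<open>Q\<close>, and \<open>Q_l\<close> at a maximiser \<open>l\<close> closes the gap.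

  Upper bound on the expected distance: for each output word, truncating the likelihood bounds the
  mean absolute deviation of the empirical average by its moment of order \<open>l\<close>; the resulting bound
  tensorises exactly.

  Lower bound: let \<open>T_y\<close> be the codewords jointly typical with \<open>y\<close> under the optimal \<open>Q_l\<close>. Averaging
  the likelihood over \<open>T_y\<close> and over its complement does not increase the deviation, and reduces it to
  that of a binomial variable, which is of the order of its standard deviation or its mean, whichever
  is smaller. Non-degeneracy makes the likelihood on \<open>T_y\<close> exponentially larger than the output
  probability of \<open>y\<close>, so that subtracting the latter costs only a constant factor.
\<close>

section \<open>Deviations of i.i.d. sums\<close>

text \<open>Shaped like the codebook average in \<open>expected_tv\<close>, with
  \<open>S = seqs n\<close> and \<open>p = iid P n\<close>. With single letters as samples it is
  instead the expectation over one word, as in \<open>chebyshev_iid\<close>.\<close>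

definition iid_expect :: "('a \<Rightarrow> real) \<Rightarrow> 'a set \<Rightarrow> nat \<Rightarrow> ((nat \<Rightarrow> 'a) \<Rightarrow> real) \<Rightarrow> real" where
  "iid_expect p S M F = (\<Sum>c\<in>PiE {..<M} (\<lambda>_. S). (\<Prod>j<M. p (c j)) * F c)"

lemma iid_expect_0: "iid_expect p S 0 F = F (\<lambda>_. undefined)"
  by (simp add: iid_expect_def)

text \<open>Conditioning on the last sample; the moment computations are inductions on the number of
  samples through this recursion.\<close>

lemma iid_expect_Suc:
  "iid_expect p S (Suc M) F = (\<Sum>x\<in>S. p x * iid_expect p S M (\<lambda>c. F (c(M := x))))"
proof -
  let ?g = "\<lambda>(y, g). g(M := y)"
  have "iid_expect p S (Suc M) F =
      (\<Sum>c\<in>?g ` (S \<times> PiE {..<M} (\<lambda>_. S)). (\<Prod>j<Suc M. p (c j)) * F c)"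
    by (simp add: iid_expect_def lessThan_Suc PiE_insert_eq)
  also have "\<dots> = (\<Sum>(x, c)\<in>S \<times> PiE {..<M} (\<lambda>_. S).
      (\<Prod>j<Suc M. p ((c(M := x)) j)) * F (c(M := x)))"
    using inj_combinator[of M "{..<M}" "\<lambda>_. S"]
    by (subst sum.reindex) (auto simp: case_prod_unfold)
  also have "\<dots> = (\<Sum>x\<in>S. \<Sum>c\<in>PiE {..<M} (\<lambda>_. S).
      (\<Prod>j<Suc M. p ((c(M := x)) j)) * F (c(M := x)))"
    by (simp add: sum.cartesian_product)
  also have "\<dots> = (\<Sum>x\<in>S. \<Sum>c\<in>PiE {..<M} (\<lambda>_. S).
      p x * ((\<Prod>j<M. p (c j)) * F (c(M := x))))"
    by (intro sum.cong refl) (simp add: mult_ac)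
  finally show ?thesis
    by (simp add: iid_expect_def sum_distrib_left)
qed

lemma iid_expect_sum_Suc:
  "iid_expect p S (Suc M) (\<lambda>c. \<phi> (\<Sum>j<Suc M. f (c j))) =
   (\<Sum>x\<in>S. p x * iid_expect p S M (\<lambda>c. \<phi> ((\<Sum>j<M. f (c j)) + f x)))"
  unfolding iid_expect_Suc by simp

lemma iid_expect_add:
  "iid_expect p S M (\<lambda>c. F c + H c) = iid_expect p S M F + iid_expect p S M H"
  by (simp add: iid_expect_def sum.distrib algebra_simps)

lemma iid_expect_cmult: "iid_expect p S M (\<lambda>c. k * F c) = k * iid_expect p S M F"
  by (simp add: iid_expect_def sum_distrib_left algebra_simps)

lemma iid_expect_diff:
  "iid_expect p S M (\<lambda>c. F c - H c) = iid_expect p S M F - iid_expect p S M H"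
  by (simp add: iid_expect_def sum_subtractf algebra_simps)

lemma iid_expect_sum:
  "iid_expect p S M (\<lambda>c. \<Sum>y\<in>Y. F y c) = (\<Sum>y\<in>Y. iid_expect p S M (F y))"
  unfolding iid_expect_def sum_distrib_left by (rule sum.swap)

section \<open>Moments and mean absolute deviations of sums of independent samples\<close>

locale finite_prob =
  fixes p :: "'a \<Rightarrow> real" and S :: "'a set"
  assumes finite_S: "finite S"
    and p_nonneg: "\<And>x. x \<in> S \<Longrightarrow> 0 \<le> p x"
    and sum_p: "sum p S = 1"
begin

abbreviation "EM \<equiv> iid_expect p S"

lemma iid_expect_mono:
  assumes "\<And>c. c \<in> PiE {..<M} (\<lambda>_. S) \<Longrightarrow> F c \<le> H c"
  shows "EM M F \<le> EM M H"
  unfolding iid_expect_def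
  by (intro sum_mono mult_left_mono assms prod_nonneg) (auto intro!: p_nonneg)

lemma sum_p_mult: "(\<Sum>x\<in>S. p x * k) = k"
  by (simp add: sum_p flip: sum_distrib_right)

lemma iid_expect_const: "EM M (\<lambda>_. k) = k"
  by (induction M) (simp_all add: iid_expect_0 iid_expect_Suc sum_p_mult)

lemma iid_expect_affine: "EM M (\<lambda>c. F c + k) = EM M F + k"
  by (simp add: iid_expect_add iid_expect_const)

lemma iid_expect_mean: "EM M (\<lambda>c. \<Sum>j<M. f (c j)) = M * (\<Sum>x\<in>S. p x * f x)"
proof (induction M)
  case (Suc M)
  have "EM (Suc M) (\<lambda>c. \<Sum>j<Suc M. f (c j)) =
      (\<Sum>x\<in>S. p x * (M * (\<Sum>x\<in>S. p x * f x)) + p x * f x)"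
    by (simp only: iid_expect_sum_Suc[where \<phi> = "\<lambda>t. t"] iid_expect_affine Suc distrib_left)
  also have "\<dots> = Suc M * (\<Sum>x\<in>S. p x * f x)"
    by (simp only: sum.distrib sum_p_mult) (simp add: algebra_simps)
  finally show ?case .
qed (simp add: iid_expect_0)

lemma iid_expect_abs_le: "EM M (\<lambda>c. \<bar>\<Sum>j<M. f (c j)\<bar>) \<le> M * (\<Sum>x\<in>S. p x * \<bar>f x\<bar>)"
  unfolding iid_expect_mean[symmetric] by (rule iid_expect_mono) (rule sum_abs)

lemma iid_expect_square:
  assumes "(\<Sum>x\<in>S. p x * f x) = 0"
  shows "EM M (\<lambda>c. (\<Sum>j<M. f (c j))\<^sup>2) = M * (\<Sum>x\<in>S. p x * (f x)\<^sup>2)"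
proof (induction M)
  case (Suc M)
  let ?v = "\<Sum>x\<in>S. p x * (f x)\<^sup>2"
  have *: "EM M (\<lambda>c. ((\<Sum>j<M. f (c j)) + f x)\<^sup>2) = M * ?v + (f x)\<^sup>2" for x
  proof -
    have "EM M (\<lambda>c. ((\<Sum>j<M. f (c j)) + f x)\<^sup>2) =
        EM M (\<lambda>c. (\<Sum>j<M. f (c j))\<^sup>2 + 2 * f x * (\<Sum>j<M. f (c j)) + (f x)\<^sup>2)"
      by (simp add: power2_sum algebra_simps)
    also have "\<dots> = M * ?v + (f x)\<^sup>2"
      by (simp add: iid_expect_const iid_expect_add iid_expect_cmult iid_expect_mean Suc assms)
    finally show ?thesis .
  qed
  have "EM (Suc M) (\<lambda>c. (\<Sum>j<Suc M. f (c j))\<^sup>2) = (\<Sum>x\<in>S. p x * (M * ?v) + p x * (f x)\<^sup>2)"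
    by (simp only: iid_expect_sum_Suc[where \<phi> = "\<lambda>t. t\<^sup>2"] * distrib_left)
  also have "\<dots> = Suc M * ?v"
    by (simp only: sum.distrib sum_p_mult) (simp add: algebra_simps)
  finally show ?case .
qed (simp add: iid_expect_0)

text \<open>The variance of \<open>\<bar>F\<bar>\<close> is nonnegative, so the squared mean of
  \<open>\<bar>F\<bar>\<close> is at most the second moment.\<close>

lemma iid_expect_abs_le_sqrt:
  assumes "(\<Sum>x\<in>S. p x * f x) = 0"
  shows "EM M (\<lambda>c. \<bar>\<Sum>j<M. f (c j)\<bar>) \<le> sqrt (M * (\<Sum>x\<in>S. p x * (f x)\<^sup>2))"
proof -
  let ?F = "\<lambda>c. \<Sum>j<M. f (c j)" and ?a = "EM M (\<lambda>c. \<bar>\<Sum>j<M. f (c j)\<bar>)"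
  have "0 \<le> EM M (\<lambda>c. (\<bar>?F c\<bar> - ?a)\<^sup>2)"
    using iid_expect_mono[of M "\<lambda>_. 0"] by (simp add: iid_expect_const)
  also have "\<dots> = EM M (\<lambda>c. (?F c)\<^sup>2 + (- 2 * ?a) * \<bar>?F c\<bar> + ?a\<^sup>2)"
    by (simp add: power2_diff algebra_simps)
  also have "\<dots> = EM M (\<lambda>c. (?F c)\<^sup>2) + (- 2 * ?a) * ?a + ?a\<^sup>2"
    by (simp only: iid_expect_const iid_expect_add iid_expect_cmult)
  finally have "?a\<^sup>2 \<le> M * (\<Sum>x\<in>S. p x * (f x)\<^sup>2)"
    unfolding iid_expect_square[OF assms] by (simp add: power2_eq_square)
  then show ?thesis by (rule real_le_rsqrt)
qed

text \<open>In the expansion for one more sample, the third moment of the partial sum is multiplied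
  by the mean of \<open>f\<close>, and the first moment is 0, so both drop out;
  \<open>\<bar>f\<bar> \<le> 1\<close> reduces \<open>f ^ 4\<close> to the variance.\<close>

lemma iid_expect_power4_le:
  assumes "(\<Sum>x\<in>S. p x * f x) = 0" and "\<And>x. x \<in> S \<Longrightarrow> \<bar>f x\<bar> \<le> 1"
    and v: "v = (\<Sum>x\<in>S. p x * (f x)\<^sup>2)"
  shows "EM M (\<lambda>c. (\<Sum>j<M. f (c j)) ^ 4) \<le> M * v * (1 + 3 * (M * v))"
proof (induction M)
  case (Suc M)
  let ?F = "\<lambda>c. \<Sum>j<M. f (c j)"
  have v0: "0 \<le> v" unfolding v by (intro sum_nonneg mult_nonneg_nonneg p_nonneg) auto
  have *: "EM M (\<lambda>c. (?F c + f x) ^ 4) \<le> M * v * (1 + 3 * (M * v))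
      + 4 * EM M (\<lambda>c. ?F c ^ 3) * f x + (6 * (M * v) + 1) * (f x)\<^sup>2" if "x \<in> S" for x
  proof -
    have "EM M (\<lambda>c. (?F c + f x) ^ 4) = EM M (\<lambda>c. ?F c ^ 4 + 4 * f x * ?F c ^ 3
        + 6 * (f x)\<^sup>2 * (?F c)\<^sup>2 + 4 * f x ^ 3 * ?F c + f x ^ 4)"
      by (intro arg_cong[where f = "EM M"] ext) (simp add: eval_nat_numeral algebra_simps)
    also have "\<dots> = EM M (\<lambda>c. ?F c ^ 4) + 4 * f x * EM M (\<lambda>c. ?F c ^ 3)
        + 6 * (f x)\<^sup>2 * (M * v) + f x ^ 4"
      by (simp add: iid_expect_const iid_expect_add iid_expect_cmult iid_expect_mean
            iid_expect_square assms)
    also have "f x ^ 4 \<le> (f x)\<^sup>2"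
    proof -
      have "\<bar>f x\<bar> ^ 4 \<le> \<bar>f x\<bar> ^ 2"
        using assms(2)[OF that] by (intro power_decreasing) auto
      then show ?thesis by simp
    qed
    finally show ?thesis using Suc by (simp add: algebra_simps)
  qed
  have "EM (Suc M) (\<lambda>c. (\<Sum>j<Suc M. f (c j)) ^ 4) \<le> (\<Sum>x\<in>S. p x * (M * v * (1 + 3 * (M * v))
      + 4 * EM M (\<lambda>c. ?F c ^ 3) * f x + (6 * (M * v) + 1) * (f x)\<^sup>2))"
    unfolding iid_expect_sum_Suc[where \<phi> = "\<lambda>t. t ^ 4"]
    by (intro sum_mono mult_left_mono * p_nonneg)
  also have "\<dots> = (\<Sum>x\<in>S. p x) * (M * v * (1 + 3 * (M * v)))
      + 4 * EM M (\<lambda>c. ?F c ^ 3) * (\<Sum>x\<in>S. p x * f x)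
      + (6 * (M * v) + 1) * (\<Sum>x\<in>S. p x * (f x)\<^sup>2)"
    by (simp add: sum_distrib_left sum_distrib_right sum.distrib algebra_simps)
  also have "\<dots> = M * v * (1 + 3 * (M * v)) + (6 * (M * v) + 1) * v"
    by (simp add: sum_p assms)
  also have "\<dots> \<le> Suc M * v * (1 + 3 * (Suc M * v))"
    using v0 by (simp add: algebra_simps)
  finally show ?case .
qed (simp add: iid_expect_0)

text \<open>The fourth moment turns the variance into an \<open>L\<^sup>1\<close> lower bound through
  \<open>2 u \<ge> 3 u\<^sup>2 - u\<^sup>4\<close>, applied to the normalised deviation.\<close>

lemma iid_expect_abs_ge:
  assumes "(\<Sum>x\<in>S. p x * f x) = 0" and "\<And>x. x \<in> S \<Longrightarrow> \<bar>f x\<bar> \<le> 1"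
    and v: "v = (\<Sum>x\<in>S. p x * (f x)\<^sup>2)"
  shows "M * v / sqrt (1 + 3 * (M * v)) \<le> EM M (\<lambda>c. \<bar>\<Sum>j<M. f (c j)\<bar>)"
proof -
  let ?F = "\<lambda>c. \<Sum>j<M. f (c j)"
  \<comment> \<open>\<open>s\<^sup>2\<close> is the quotient of the fourth-moment bound by the
    second moment \<open>M * v\<close>; the two terms of \<open>pt\<close> then average to 3/2 and
    to at most 1/2 of \<open>M * v / s\<close>.\<close>
  define s where "s = sqrt (1 + 3 * (M * v))"
  have v0: "0 \<le> v" unfolding v by (intro sum_nonneg mult_nonneg_nonneg p_nonneg) auto
  have s: "0 < s" "s\<^sup>2 = 1 + 3 * (M * v)"
    using v0 by (auto simp: s_def add_pos_nonneg)
  have pt: "3 / (2 * s) * t\<^sup>2 - 1 / (2 * s ^ 3) * t ^ 4 \<le> \<bar>t\<bar>" for t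
  proof -
    define u where "u = \<bar>t\<bar> / s"
    have u: "0 \<le> u" "\<bar>t\<bar> = s * u" using s by (auto simp: u_def)
    have "0 \<le> (u - 1)\<^sup>2 * (u + 2) * u" using u by simp
    also have "\<dots> = 2 * u - 3 * u\<^sup>2 + u ^ 4" by (simp add: eval_nat_numeral algebra_simps)
    finally have "s * (3 / 2 * u\<^sup>2 - 1 / 2 * u ^ 4) \<le> s * u" using s by simp
    also have "s * (3 / 2 * u\<^sup>2 - 1 / 2 * u ^ 4) =
        3 / (2 * s) * \<bar>t\<bar>\<^sup>2 - 1 / (2 * s ^ 3) * \<bar>t\<bar> ^ 4"
      unfolding u(2) using s(1) by (simp add: field_simps eval_nat_numeral)
    finally show ?thesis by (simp flip: u(2))
  qed
  have "M * v / s = 3 / (2 * s) * (M * v) - 1 / (2 * s ^ 3) * (M * v * s\<^sup>2)"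
    using s(1) by (simp add: field_simps eval_nat_numeral)
  also have "\<dots> \<le> 3 / (2 * s) * EM M (\<lambda>c. (?F c)\<^sup>2) - 1 / (2 * s ^ 3) * EM M (\<lambda>c. ?F c ^ 4)"
    using iid_expect_power4_le[OF assms, of M] s
    by (intro diff_mono mult_left_mono) (auto simp: iid_expect_square assms)
  also have "\<dots> = EM M (\<lambda>c. 3 / (2 * s) * (?F c)\<^sup>2 - 1 / (2 * s ^ 3) * ?F c ^ 4)"
    by (simp only: iid_expect_diff iid_expect_cmult)
  also have "\<dots> \<le> EM M (\<lambda>c. \<bar>?F c\<bar>)"
    by (intro iid_expect_mono pt)
  finally show ?thesis by (simp add: s_def)
qed

text \<open>A replacement argument: samples are exchanged one at a time, and the rest of the sum
  acts as the constant shift \<open>t\<close>.\<close>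

lemma iid_expect_abs_contract:
  assumes "\<And>t. (\<Sum>x\<in>S. p x * \<bar>t + g x\<bar>) \<le> (\<Sum>x\<in>S. p x * \<bar>t + f x\<bar>)"
  shows "EM M (\<lambda>c. \<bar>(\<Sum>j<M. g (c j)) + a\<bar>) \<le> EM M (\<lambda>c. \<bar>(\<Sum>j<M. f (c j)) + a\<bar>)"
proof (induction M arbitrary: a)
  case (Suc M)
  have "EM (Suc M) (\<lambda>c. \<bar>(\<Sum>j<Suc M. g (c j)) + a\<bar>) =
      (\<Sum>x\<in>S. p x * EM M (\<lambda>c. \<bar>(\<Sum>j<M. g (c j)) + (g x + a)\<bar>))"
    unfolding iid_expect_sum_Suc[where \<phi> = "\<lambda>t. \<bar>t + a\<bar>"] by (simp add: add.assoc)
  also have "\<dots> \<le> (\<Sum>x\<in>S. p x * EM M (\<lambda>c. \<bar>(\<Sum>j<M. f (c j)) + (g x + a)\<bar>))"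
    by (intro sum_mono mult_left_mono Suc p_nonneg)
  also have "\<dots> = EM M (\<lambda>c. \<Sum>x\<in>S. p x * \<bar>((\<Sum>j<M. f (c j)) + a) + g x\<bar>)"
    by (simp only: iid_expect_sum iid_expect_cmult) (simp add: ac_simps)
  also have "\<dots> \<le> EM M (\<lambda>c. \<Sum>x\<in>S. p x * \<bar>((\<Sum>j<M. f (c j)) + a) + f x\<bar>)"
    by (intro iid_expect_mono assms)
  also have "\<dots> = (\<Sum>x\<in>S. p x * EM M (\<lambda>c. \<bar>(\<Sum>j<M. f (c j)) + (f x + a)\<bar>))"
    by (simp only: iid_expect_sum iid_expect_cmult) (simp add: ac_simps)
  also have "\<dots> = EM (Suc M) (\<lambda>c. \<bar>(\<Sum>j<Suc M. f (c j)) + a\<bar>)"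
    unfolding iid_expect_sum_Suc[where \<phi> = "\<lambda>t. \<bar>t + a\<bar>"] by (simp add: add.assoc)
  finally show ?case .
qed (simp add: iid_expect_0)

text \<open>By convexity of the absolute value, replacing \<open>z - \<mu>\<close> by its
  conditional mean given membership in \<open>T\<close> does not increase the deviation. What
  remains is a multiple of a centred binomial variable, to which \<open>iid_expect_abs_ge\<close>
  applies. The denominator covers both regimes: about \<open>M * A\<close> when \<open>M * P\<close>
  is small, about \<open>M * A / sqrt (M * P)\<close> when it is large.\<close>

lemma iid_expect_dev_ge:
  fixes z :: "'a \<Rightarrow> real" and T :: "'a set"
  defines "\<mu> \<equiv> \<Sum>x\<in>S. p x * z x" and "P \<equiv> sum p T" and "A \<equiv> \<Sum>x\<in>T. p x * z x"
  assumes T: "T \<subseteq> S" and z: "\<And>x. x \<in> S \<Longrightarrow> 0 \<le> z x" and A: "4 * \<mu> * P \<le> A"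
  shows "3 / 4 * M * A / sqrt (1 + 3 * (M * P)) \<le> EM M (\<lambda>c. \<bar>\<Sum>j<M. z (c j) - \<mu>\<bar>)"
proof (cases "A = 0")
  case True
  then show ?thesis
    using iid_expect_mono[of M "\<lambda>_. 0"] by (simp add: iid_expect_const)
next
  case False
  have finT: "finite T" using T finite_S finite_subset by blast
  have pz: "0 \<le> p x * z x" if "x \<in> S" for x using that z p_nonneg by simp
  have A0: "0 < A" using False pz T unfolding A_def by (metis (mono_tags, lifting) in_mono order_le_less sum_nonneg)
  have A\<mu>: "A \<le> \<mu>" unfolding A_def \<mu>_def using finite_S T pz by (intro sum_mono2) auto
  have P0: "0 \<le> P" unfolding P_def using T p_nonneg by (intro sum_nonneg) auto
  have Pne: "P \<noteq> 0"
  proof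
    assume "P = 0"
    then have "p x = 0" if "x \<in> T" for x
      using that finT T p_nonneg unfolding P_def by (subst (asm) sum_nonneg_eq_0_iff) auto
    then show False using False by (simp add: A_def)
  qed
  have P4: "P \<le> 1 / 4"
  proof -
    have "4 * \<mu> * P \<le> \<mu>" using A A\<mu> by linarith
    then show ?thesis using A0 A\<mu> by simp
  qed
  \<comment> \<open>Chosen so that \<open>\<kappa> * h\<close> takes the conditional means of
    \<open>z - \<mu>\<close>: \<open>A / P - \<mu>\<close> on \<open>T\<close> and
    \<open>(\<mu> - A) / (1 - P) - \<mu>\<close> off it.\<close>
  define \<kappa> where "\<kappa> = (A - \<mu> * P) / (P * (1 - P))"
  define h where "h x = (indicator T x - P :: real)" for x
  have split_S: "(\<Sum>x\<in>S. F x) = (\<Sum>x\<in>T. F x) + (\<Sum>x\<in>S - T. F x)" for F :: "'a \<Rightarrow> real"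
    using sum.subset_diff[OF T finite_S] by (simp add: add.commute)
  have PT': "sum p (S - T) = 1 - P"
    using split_S[of p] by (simp add: sum_p P_def)
  have AT': "(\<Sum>x\<in>S - T. p x * z x) = \<mu> - A"
    using split_S[of "\<lambda>x. p x * z x"] by (simp add: A_def \<mu>_def)
  have h0: "(\<Sum>x\<in>S. p x * h x) = 0"
    unfolding split_S h_def by (simp add: PT' sum_negf flip: sum_distrib_right P_def)
  have h2: "(\<Sum>x\<in>S. p x * (h x)\<^sup>2) = P * (1 - P)"
  proof -
    have "(\<Sum>x\<in>S. p x * (h x)\<^sup>2) = P * (1 - P)\<^sup>2 + (1 - P) * P\<^sup>2"
      unfolding split_S h_def by (simp add: PT' flip: sum_distrib_right P_def)
    then show ?thesis by (simp add: power2_eq_square algebra_simps)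
  qed
  have h1: "\<bar>h x\<bar> \<le> 1" for x using P0 P4 by (auto simp: h_def indicator_def)
  \<comment> \<open>Jensen's inequality on one cell, kept unnormalised to avoid dividing by the mass
    of the cell.\<close>
  have cell: "\<bar>sum p C * r + (\<Sum>x\<in>C. p x * z x) - sum p C * \<mu>\<bar> \<le> (\<Sum>x\<in>C. p x * \<bar>r + (z x - \<mu>)\<bar>)"
    if "C \<subseteq> S" for C r
  proof -
    have "sum p C * r + (\<Sum>x\<in>C. p x * z x) - sum p C * \<mu> = (\<Sum>x\<in>C. p x * (r + (z x - \<mu>)))"
      by (simp add: sum_distrib_left sum_distrib_right sum.distrib sum_subtractf algebra_simps)
    also have "\<bar>\<dots>\<bar> \<le> (\<Sum>x\<in>C. \<bar>p x * (r + (z x - \<mu>))\<bar>)" by (rule sum_abs)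
    also have "\<dots> = (\<Sum>x\<in>C. p x * \<bar>r + (z x - \<mu>)\<bar>)"
      using that p_nonneg by (intro sum.cong) (auto simp: abs_mult)
    finally show ?thesis .
  qed
  have contract: "(\<Sum>x\<in>S. p x * \<bar>r + \<kappa> * h x\<bar>) \<le> (\<Sum>x\<in>S. p x * \<bar>r + (z x - \<mu>)\<bar>)" for r
  proof -
    have "(\<Sum>x\<in>S. p x * \<bar>r + \<kappa> * h x\<bar>) =
        P * \<bar>r + \<kappa> * (1 - P)\<bar> + (1 - P) * \<bar>r - \<kappa> * P\<bar>"
      unfolding split_S h_def by (simp add: PT' flip: sum_distrib_right P_def)
    also have "\<dots> = \<bar>P * (r + \<kappa> * (1 - P))\<bar> + \<bar>(1 - P) * (r - \<kappa> * P)\<bar>"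
      using P0 P4 by (simp add: abs_mult)
    also have "P * (r + \<kappa> * (1 - P)) = P * r + A - P * \<mu>"
      using Pne P4 by (simp add: \<kappa>_def field_simps)
    also have "(1 - P) * (r - \<kappa> * P) = (1 - P) * r + (\<mu> - A) - (1 - P) * \<mu>"
    proof -
      have "(1 - P) * (\<kappa> * P) = A - \<mu> * P"
        using Pne P4 by (simp add: \<kappa>_def)
      then show ?thesis by (simp add: algebra_simps)
    qed
    also have "\<bar>P * r + A - P * \<mu>\<bar> + \<bar>(1 - P) * r + (\<mu> - A) - (1 - P) * \<mu>\<bar>
        \<le> (\<Sum>x\<in>T. p x * \<bar>r + (z x - \<mu>)\<bar>) + (\<Sum>x\<in>S - T. p x * \<bar>r + (z x - \<mu>)\<bar>)"
      using cell[of T r] cell[of "S - T" r] T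
      by (intro add_mono) (auto simp: PT' AT' simp flip: P_def A_def)
    finally show ?thesis by (simp add: split_S)
  qed
  define v where "v = P * (1 - P)"
  have v: "0 < v" "v \<le> P" using Pne P0 P4 by (auto simp: v_def mult_le_cancel_left1)
  \<comment> \<open>\<open>\<kappa> * v = A - \<mu> * P\<close>, and the hypothesis bounds
    \<open>\<mu> * P\<close> by \<open>A / 4\<close>.\<close>
  have \<kappa>: "3 / 4 * A \<le> \<kappa> * v" "0 \<le> \<kappa>"
    using A A0 v by (auto simp: \<kappa>_def v_def[symmetric])
  have "3 / 4 * M * A / sqrt (1 + 3 * (M * P)) \<le> \<kappa> * v * M / sqrt (1 + 3 * (M * v))"
    using mult_left_mono[OF \<kappa>(1), of "real M"] mult_left_mono[OF v(2), of "real M"] \<kappa>(2) A0 v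
    by (intro frac_le) (auto simp: mult_ac add_pos_nonneg)
  also have "\<dots> \<le> \<kappa> * EM M (\<lambda>c. \<bar>\<Sum>j<M. h (c j)\<bar>)"
    using mult_left_mono[OF iid_expect_abs_ge[OF h0 h1 h2[symmetric], of M] \<kappa>(2)]
    by (simp add: v_def mult_ac)
  also have "\<dots> = EM M (\<lambda>c. \<bar>(\<Sum>j<M. \<kappa> * h (c j)) + 0\<bar>)"
    using \<kappa>(2) by (simp add: abs_mult flip: sum_distrib_left iid_expect_cmult)
  also have "\<dots> \<le> EM M (\<lambda>c. \<bar>(\<Sum>j<M. z (c j) - \<mu>) + 0\<bar>)"
    by (rule iid_expect_abs_contract) (rule contract)
  finally show ?thesis by simp
qed

text \<open>Truncating at \<open>(M E z\<^sup>l)\<^bsup>1/l\<^esup>\<close> balances the variance of the bounded part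
  against the mean of the tail.\<close>

lemma iid_expect_dev_le:
  fixes z :: "'a \<Rightarrow> real"
  defines "\<mu> \<equiv> \<Sum>x\<in>S. p x * z x"
  assumes z: "\<And>x. x \<in> S \<Longrightarrow> 0 \<le> z x" and l: "1 \<le> l" "l \<le> 2"
  shows "EM M (\<lambda>c. \<bar>\<Sum>j<M. z (c j) - \<mu>\<bar>) \<le> 3 * (M * (\<Sum>x\<in>S. p x * z x powr l)) powr (1 / l)"
proof -
  define m where "m = (\<Sum>x\<in>S. p x * z x powr l)"
  have m0: "0 \<le> m" unfolding m_def using p_nonneg by (intro sum_nonneg) auto
  show ?thesis
  proof (cases "M * m = 0")
    \<comment> \<open>Here the truncation level would be 0; but either there are no samples, or
      \<open>z\<close> vanishes wherever \<open>p\<close> does not, and the deviation is 0.\<close>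
    case True
    have "M * (\<Sum>x\<in>S. p x * \<bar>z x - \<mu>\<bar>) = 0"
    proof (cases "M = 0")
      case False
      then have "m = 0" using True by simp
      then have "p x * z x powr l = 0" if "x \<in> S" for x
        using that p_nonneg finite_S unfolding m_def by (subst (asm) sum_nonneg_eq_0_iff) auto
      then have *: "p x = 0 \<or> z x = 0" if "x \<in> S" for x
        using that by (metis mult_eq_0_iff powr_eq_0_iff)
      then have "\<mu> = 0" unfolding \<mu>_def by (intro sum.neutral) auto
      with * have "(\<Sum>x\<in>S. p x * \<bar>z x - \<mu>\<bar>) = 0" by (intro sum.neutral) auto
      then show ?thesis by simp
    qed simp
    then show ?thesis
      using iid_expect_abs_le[of M "\<lambda>x. z x - \<mu>"] by (smt (verit) powr_ge_zero)
  next
    case False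
    then have Mm: "0 < M * m" using m0 by (metis mult_nonneg_nonneg of_nat_0_le_iff order_le_less)
    define \<tau> where "\<tau> = (M * m) powr (1 / l)"
    have \<tau>: "0 < \<tau>" "\<tau> powr l = M * m" using Mm l False by (simp_all add: \<tau>_def powr_powr)
    define z1 where "z1 x = (if z x \<le> \<tau> then z x else 0)" for x
    define z2 where "z2 x = (if z x \<le> \<tau> then 0 else z x)" for x
    define \<mu>1 \<mu>2 where "\<mu>1 = (\<Sum>x\<in>S. p x * z1 x)" and "\<mu>2 = (\<Sum>x\<in>S. p x * z2 x)"
    have zz: "z x = z1 x + z2 x" for x by (simp add: z1_def z2_def)
    have \<mu>\<mu>: "\<mu> = \<mu>1 + \<mu>2"
      unfolding \<mu>_def \<mu>1_def \<mu>2_def zz by (simp add: sum.distrib algebra_simps)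
    have z20: "0 \<le> z2 x" if "x \<in> S" for x
      using z[OF that] by (auto simp: z1_def z2_def)
    have \<mu>20: "0 \<le> \<mu>2" unfolding \<mu>2_def using z20 p_nonneg by (intro sum_nonneg) auto
    \<comment> \<open>\<open>b1\<close> and \<open>b2\<close> trade powers of \<open>z\<close> for
      powers of \<open>\<tau>\<close>; they need \<open>2 - l \<ge> 0\<close> below the level and
      \<open>1 - l \<le> 0\<close> above it, which is where the range of \<open>l\<close>
      enters.\<close>
    have b1: "(z1 x)\<^sup>2 \<le> \<tau> powr (2 - l) * z x powr l" if "x \<in> S" for x
    proof (cases "0 < z x \<and> z x \<le> \<tau>")
      case True
      then have "(z1 x)\<^sup>2 = z x powr (2 - l) * z x powr l"
        by (simp add: z1_def powr_numeral flip: powr_add)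
      also have "\<dots> \<le> \<tau> powr (2 - l) * z x powr l"
        using True l by (intro mult_right_mono powr_mono2) auto
      finally show ?thesis .
    qed (use z[OF that] in \<open>auto simp: z1_def\<close>)
    have b2: "z2 x \<le> \<tau> powr (1 - l) * z x powr l" for x
    proof (cases "z x \<le> \<tau>")
      case False
      then have "z2 x = z x powr (1 - l) * z x powr l"
        using \<tau>(1) by (simp add: z2_def flip: powr_add)
      also have "\<dots> \<le> \<tau> powr (1 - l) * z x powr l"
        using False l \<tau>(1) by (intro mult_right_mono powr_mono2') auto
      finally show ?thesis .
    qed (simp add: z2_def)
    have "EM M (\<lambda>c. \<bar>\<Sum>j<M. z1 (c j) - \<mu>1\<bar>) \<le> sqrt (M * (\<Sum>x\<in>S. p x * (z1 x - \<mu>1)\<^sup>2))"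
      by (rule iid_expect_abs_le_sqrt) (simp add: right_diff_distrib sum_subtractf sum_p_mult \<mu>1_def)
    also have "(\<Sum>x\<in>S. p x * (z1 x - \<mu>1)\<^sup>2) = (\<Sum>x\<in>S. p x * (z1 x)\<^sup>2) - \<mu>1\<^sup>2"
    proof -
      have "(\<Sum>x\<in>S. p x * (z1 x - \<mu>1)\<^sup>2) =
          (\<Sum>x\<in>S. p x * (z1 x)\<^sup>2) - 2 * \<mu>1 * (\<Sum>x\<in>S. p x * z1 x) + (\<Sum>x\<in>S. p x * \<mu>1\<^sup>2)"
        by (simp add: power2_diff algebra_simps sum.distrib sum_subtractf sum_distrib_left)
      then show ?thesis by (simp add: sum_p_mult power2_eq_square flip: \<mu>1_def)
    qed
    also have "sqrt (M * ((\<Sum>x\<in>S. p x * (z1 x)\<^sup>2) - \<mu>1\<^sup>2)) \<le> sqrt (M * (\<tau> powr (2 - l) * m))"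
    proof -
      have "(\<Sum>x\<in>S. p x * (z1 x)\<^sup>2) \<le> (\<Sum>x\<in>S. p x * (\<tau> powr (2 - l) * z x powr l))"
        by (intro sum_mono mult_left_mono b1 p_nonneg)
      also have "\<dots> = \<tau> powr (2 - l) * m" by (simp add: m_def sum_distrib_left mult_ac)
      finally show ?thesis
        by (intro real_sqrt_le_mono mult_left_mono) (auto intro: order_trans[rotated])
    qed
    also have "M * (\<tau> powr (2 - l) * m) = \<tau> powr (2 - l) * \<tau> powr l" using \<tau>(2) by simp
    also have "\<dots> = \<tau>\<^sup>2" using \<tau>(1) by (simp add: powr_numeral flip: powr_add)
    finally have e1: "EM M (\<lambda>c. \<bar>\<Sum>j<M. z1 (c j) - \<mu>1\<bar>) \<le> \<tau>" using \<tau>(1) by simp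
    have "EM M (\<lambda>c. \<bar>\<Sum>j<M. z2 (c j) - \<mu>2\<bar>) \<le> M * (\<Sum>x\<in>S. p x * \<bar>z2 x - \<mu>2\<bar>)"
      by (rule iid_expect_abs_le)
    \<comment> \<open>The tail and its centring each contribute one mean, hence the factor 2, and 3
      in total.\<close>
    also have "\<dots> \<le> M * (\<Sum>x\<in>S. p x * z2 x + p x * \<mu>2)"
      unfolding distrib_left[symmetric] using z20 \<mu>20 p_nonneg
      by (intro mult_left_mono sum_mono) (auto simp: abs_if add_nonneg_nonneg)
    also have "\<dots> = 2 * (M * \<mu>2)" by (simp add: sum.distrib sum_p_mult \<mu>2_def)
    also have "\<dots> \<le> 2 * (M * (\<tau> powr (1 - l) * m))"
    proof -
      have "\<mu>2 \<le> (\<Sum>x\<in>S. p x * (\<tau> powr (1 - l) * z x powr l))"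
        unfolding \<mu>2_def by (intro sum_mono mult_left_mono b2 p_nonneg)
      also have "\<dots> = \<tau> powr (1 - l) * m" by (simp add: m_def sum_distrib_left mult_ac)
      finally show ?thesis by (intro mult_left_mono) auto
    qed
    also have "M * (\<tau> powr (1 - l) * m) = \<tau> powr (1 - l) * \<tau> powr l" using \<tau>(2) by simp
    also have "\<dots> = \<tau>" using \<tau>(1) by (simp flip: powr_add)
    finally have e2: "EM M (\<lambda>c. \<bar>\<Sum>j<M. z2 (c j) - \<mu>2\<bar>) \<le> 2 * \<tau>" .
    have "EM M (\<lambda>c. \<bar>\<Sum>j<M. z (c j) - \<mu>\<bar>) \<le>
        EM M (\<lambda>c. \<bar>\<Sum>j<M. z1 (c j) - \<mu>1\<bar> + \<bar>\<Sum>j<M. z2 (c j) - \<mu>2\<bar>)"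
    proof (rule iid_expect_mono)
      fix c
      have "(\<Sum>j<M. z (c j) - \<mu>) = (\<Sum>j<M. z1 (c j) - \<mu>1) + (\<Sum>j<M. z2 (c j) - \<mu>2)"
        unfolding zz \<mu>\<mu> sum.distrib[symmetric] by (intro sum.cong) auto
      then show "\<bar>\<Sum>j<M. z (c j) - \<mu>\<bar> \<le> \<bar>\<Sum>j<M. z1 (c j) - \<mu>1\<bar> + \<bar>\<Sum>j<M. z2 (c j) - \<mu>2\<bar>"
        by (simp only: abs_triangle_ineq)
    qed
    also have "\<dots> \<le> 3 * \<tau>" using e1 e2 by (simp add: iid_expect_add)
    finally show ?thesis by (simp add: \<tau>_def m_def)
  qed
qed

end

section \<open>The variational problem\<close>

text \<open>In nats and always finite, since division by zero gives 0; it agrees with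
  \<open>rel_ent\<close> only under absolute continuity.\<close>

definition KL :: "('a::finite \<Rightarrow> real) \<Rightarrow> ('a \<Rightarrow> real) \<Rightarrow> real" where
  "KL Q P = (\<Sum>a\<in>UNIV. Q a * ln (Q a / P a))"

lemma rel_ent_eq_KL:
  assumes "is_pmf Q" and "\<And>a. 0 < Q a \<Longrightarrow> P a \<noteq> 0"
  shows "rel_ent b Q P = ereal (KL Q P / ln b)"
proof -
  have "(\<Sum>a\<in>{a. Q a > 0}. Q a * log b (Q a / P a)) = (\<Sum>a\<in>UNIV. Q a * log b (Q a / P a))"
    using assms(1) by (intro sum.mono_neutral_left) (auto simp: is_pmf_def order_le_less)
  then show ?thesis
    using assms(2) unfolding rel_ent_def KL_def log_def by (auto simp: sum_divide_distrib)
qed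

text \<open>Gibbs' inequality from \<open>ln t \<le> t - 1\<close>. Total mass below one is allowed
  because a reference measure in \<open>variational_ge\<close> may lose mass.\<close>

lemma KL_nonneg:
  assumes "is_pmf Q" and r: "\<And>a. 0 \<le> r a" "sum r UNIV \<le> 1" and ac: "\<And>a. 0 < Q a \<Longrightarrow> 0 < r a"
  shows "0 \<le> KL Q r"
proof -
  have "Q a - r a \<le> Q a * ln (Q a / r a)" for a
  proof (cases "Q a = 0")
    case False
    then have Q: "0 < Q a" "0 < r a" using assms by (auto simp: is_pmf_def order_le_less)
    have "ln (r a / Q a) \<le> r a / Q a - 1" using Q by (intro ln_le_minus_one) auto
    then have "1 - r a / Q a \<le> ln (Q a / r a)" using Q by (simp add: ln_div)
    then have "Q a * (1 - r a / Q a) \<le> Q a * ln (Q a / r a)" using Q by simp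
    then show ?thesis using Q by (simp add: algebra_simps)
  qed (use r in auto)
  then have "(\<Sum>a\<in>UNIV. Q a - r a) \<le> KL Q r" unfolding KL_def by (rule sum_mono)
  then show ?thesis using assms by (simp add: sum_subtractf is_pmf_def)
qed

lemma continuous_on_powr_exponent:
  fixes c :: real and f :: "real \<Rightarrow> real"
  assumes "continuous_on A f"
  shows "continuous_on A (\<lambda>l. c powr f l)"
  using assms by (cases "c = 0") (auto intro!: continuous_intros)

text \<open>\<open>u powr l - u\<close> and \<open>ln u\<close> have the same sign, so
  \<open>u powr l * ln u \<ge> u * ln u\<close>, and \<open>ln u \<ge> 1 - 1 / u\<close>. It is
  applied to likelihood ratios \<open>u\<close>, for which \<open>u - 1\<close> has mean
  zero.\<close>

lemma powr_mult_ln_ge: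
  fixes u l :: real
  assumes "0 \<le> u" "1 \<le> l"
  shows "u - 1 \<le> u powr l * ln u" and "u \<noteq> 1 \<Longrightarrow> u - 1 < u powr l * ln u"
proof -
  have *: "u - 1 \<le> u powr l * ln u \<and> (u \<noteq> 1 \<longrightarrow> u - 1 < u powr l * ln u)"
  proof (cases "u = 0")
    case False
    then have u: "0 < u" using assms by simp
    have "u * ln u \<le> u powr l * ln u"
    proof (cases "1 \<le> u")
      case True
      then have "u powr 1 \<le> u powr l" using assms by (intro powr_mono) auto
      then show ?thesis using True by (intro mult_right_mono) auto
    next
      case False
      then have "u powr l \<le> u powr 1" using assms u by (intro powr_mono') auto
      then show ?thesis using False u by (intro mult_right_mono_neg) auto
    qed
    moreover have "ln (1 / u) \<le> 1 / u - 1" using u by (intro ln_le_minus_one) auto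
    moreover have "u = 1" if "ln (1 / u) = 1 / u - 1"
      using ln_eq_minus_one[of "1 / u"] that u by auto
    ultimately have "u * (1 - 1 / u) \<le> u * ln u" "u \<noteq> 1 \<Longrightarrow> u * (1 - 1 / u) < u * ln u"
      using u by (auto simp: ln_div order_le_less)
    with \<open>u * ln u \<le> u powr l * ln u\<close> u show ?thesis
      by (auto simp: right_diff_distrib)
  qed auto
  then show "u - 1 \<le> u powr l * ln u" and "u \<noteq> 1 \<Longrightarrow> u - 1 < u powr l * ln u" by auto
qed

section \<open>The tilted laws of a channel and the variational inequality\<close>

locale dmc =
  fixes P :: "'x::finite \<Rightarrow> real" and W :: "'x \<Rightarrow> 'y::finite \<Rightarrow> real"
  assumes pmf_P: "is_pmf P" and channel_W: "is_channel W"
begin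

abbreviation "PY \<equiv> out_dist P W"
abbreviation "PXY \<equiv> joint P W"

definition B :: "real \<Rightarrow> 'y \<Rightarrow> real" where
  "B l y = (\<Sum>x\<in>UNIV. P x * W x y powr l)"

text \<open>\<open>ln (Z l)\<close> is \<open>1 - 1 / l\<close> times Sibson's information of order
  \<open>l\<close> in nats, for \<open>l \<noteq> 1\<close>.\<close>

definition Z :: "real \<Rightarrow> real" where
  "Z l = (\<Sum>y\<in>UNIV. B l y powr (1 / l))"

text \<open>The minimiser of \<open>DXY Q - (1 - 1 / l) * DX Q\<close>, with \<open>DXY\<close> and \<open>DX\<close> the divergences (in nats)
  from \<open>P_XY\<close> and from \<open>P_X Q_Y\<close>.\<close>

definition tilt :: "real \<Rightarrow> 'x \<times> 'y \<Rightarrow> real" where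
  "tilt l = (\<lambda>(x, y). P x * W x y powr l * B l y powr (1 / l - 1) / Z l)"

definition DXY :: "('x \<times> 'y \<Rightarrow> real) \<Rightarrow> real" where
  "DXY Q = KL Q PXY"

definition DX :: "('x \<times> 'y \<Rightarrow> real) \<Rightarrow> real" where
  "DX Q = KL Q (\<lambda>(x, y). P x * marg_Y Q y)"

lemma P_nonneg [simp]: "0 \<le> P x" and sum_P: "sum P UNIV = 1"
  using pmf_P by (auto simp: is_pmf_def)

lemma W_nonneg [simp]: "0 \<le> W x y" and sum_W: "(\<Sum>y\<in>UNIV. W x y) = 1"
  using channel_W by (auto simp: is_channel_def is_pmf_def)

lemma PY_nonneg [simp]: "0 \<le> PY y"
  unfolding out_dist_def by (intro sum_nonneg) auto

lemma sum_PY: "sum PY UNIV = 1"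
  unfolding out_dist_def
  by (subst sum.swap) (simp add: sum_W sum_P flip: sum_distrib_left)

lemma PY_pos: "0 < PY y" if "0 < P x" "0 < W x y"
  unfolding out_dist_def using that by (intro sum_pos2[where i = x]) auto

lemma PY_posE:
  assumes "0 < PY y"
  obtains x where "0 < P x" "0 < W x y"
proof -
  have "\<exists>x. P x * W x y \<noteq> 0"
  proof (rule ccontr)
    assume "\<not> ?thesis"
    then have "PY y = 0" unfolding out_dist_def by (intro sum.neutral) auto
    then show False using assms by simp
  qed
  then obtain x where "P x \<noteq> 0" "W x y \<noteq> 0" by auto
  then show thesis using that[of x] P_nonneg[of x] W_nonneg[of x y] by (auto simp: order_le_less)
qed

lemma B_nonneg [simp]: "0 \<le> B l y"
  unfolding B_def by (intro sum_nonneg) auto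

lemma B_pos: "0 < B l y" if "0 < P x" "0 < W x y"
  unfolding B_def using that by (intro sum_pos2[where i = x]) auto

text \<open>The support of \<open>B l\<close> is the same for all \<open>l\<close>, so no zero
  appears or disappears as the order varies; the continuity proofs rest on this.\<close>

lemma B_pos_iff: "0 < B l y \<longleftrightarrow> 0 < PY y"
proof
  assume "0 < B l y"
  then obtain x where "P x * W x y powr l \<noteq> 0"
    unfolding B_def by (metis (no_types, lifting) less_irrefl sum.neutral)
  then show "0 < PY y"
    using P_nonneg[of x] W_nonneg[of x y] by (intro PY_pos[of x]) (auto simp: order_le_less)
qed (auto elim: PY_posE intro: B_pos)

lemma Z_pos: "0 < Z l"
proof -
  obtain y where "0 < PY y"
    using sum_PY PY_nonneg by (metis order_le_less sum.neutral zero_neq_one)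
  then show ?thesis
    unfolding Z_def using B_pos_iff[of l y] by (intro sum_pos2[where i = y]) auto
qed

lemma tilt_pos_iff: "0 < tilt l (x, y) \<longleftrightarrow> 0 < P x \<and> 0 < W x y"
  using B_pos[of x y l] Z_pos[of l] P_nonneg[of x] W_nonneg[of x y]
  by (auto simp: tilt_def order_le_less zero_less_divide_iff zero_less_mult_iff)

lemma tilt_nonneg: "0 \<le> tilt l z"
  using Z_pos[of l] by (auto simp: tilt_def split: prod.split)

lemma marg_tilt: "marg_Y (tilt l) y = B l y powr (1 / l) / Z l"
proof -
  have "marg_Y (tilt l) y = B l y * B l y powr (1 / l - 1) / Z l"
    by (simp add: marg_Y_def tilt_def B_def sum_distrib_right flip: sum_divide_distrib)
  also have "B l y * B l y powr (1 / l - 1) = B l y powr (1 / l)"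
    by (cases "B l y = 0") (auto simp: powr_diff abs_of_nonneg)
  finally show ?thesis .
qed

lemma sum_prod_marg: "sum Q UNIV = sum (marg_Y Q) UNIV" for Q :: "'x \<times> 'y \<Rightarrow> real"
  unfolding marg_Y_def by (subst sum.swap) (simp add: sum.cartesian_product flip: UNIV_Times_UNIV)

lemma pmf_tilt: "is_pmf (tilt l)"
proof -
  have "sum (tilt l) UNIV = 1"
    using Z_pos[of l] unfolding sum_prod_marg marg_tilt
    by (simp add: Z_def flip: sum_divide_distrib)
  then show ?thesis by (simp add: is_pmf_def tilt_nonneg)
qed

lemma marg_pos:
  assumes "is_pmf Q" "0 < Q (x, y)"
  shows "0 < marg_Y Q y"
  unfolding marg_Y_def using assms by (intro sum_pos2[where i = x]) (auto simp: is_pmf_def)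

text \<open>The chain rule for the divergence of \<open>Q\<close> from the tilted law: the first
  \<open>KL\<close> is the conditional divergence of X given Y, with weight \<open>1 / l\<close>,
  and the second is the divergence between the Y-marginals, written on pairs. The identity holds
  pointwise in the logarithms.\<close>

lemma variational_identity:
  assumes Q: "is_pmf Q" and ac: "\<And>x y. 0 < Q (x, y) \<Longrightarrow> 0 < P x \<and> 0 < W x y" and l: "0 < l"
  shows "DXY Q - (1 - 1 / l) * DX Q =
    1 / l * KL Q (\<lambda>(x, y). marg_Y Q y * (P x * W x y powr l / B l y)) +
    KL Q (\<lambda>(x, y). Q (x, y) * (B l y powr (1 / l) / Z l) / marg_Y Q y) - ln (Z l)"
proof -
  have pt: "Q (x, y) * ln (Q (x, y) / PXY (x, y)) - (1 - 1 / l) * (Q (x, y) * ln (Q (x, y) / (P x * marg_Y Q y))) =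
      1 / l * (Q (x, y) * ln (Q (x, y) / (marg_Y Q y * (P x * W x y powr l / B l y)))) +
      Q (x, y) * ln (Q (x, y) / (Q (x, y) * (B l y powr (1 / l) / Z l) / marg_Y Q y)) - Q (x, y) * ln (Z l)"
    for x y
  proof (cases "Q (x, y) = 0")
    case False
    then have Q0: "0 < Q (x, y)" using Q by (auto simp: is_pmf_def order_le_less)
    note pos = Q0 ac[OF Q0, THEN conjunct1] ac[OF Q0, THEN conjunct2] marg_pos[OF Q Q0] Z_pos[of l]
      B_pos[of x y l]
    have e1: "ln (Q (x, y) / PXY (x, y)) = ln (Q (x, y)) - ln (P x) - ln (W x y)"
      using pos by (simp add: joint_def ln_div ln_mult)
    have e2: "ln (Q (x, y) / (P x * marg_Y Q y)) = ln (Q (x, y)) - ln (P x) - ln (marg_Y Q y)"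
      using pos by (simp add: ln_div ln_mult)
    have e3: "ln (Q (x, y) / (marg_Y Q y * (P x * W x y powr l / B l y))) =
        ln (Q (x, y)) - ln (marg_Y Q y) - ln (P x) - l * ln (W x y) + ln (B l y)"
      using pos by (simp add: ln_div ln_mult ln_powr)
    have e4: "ln (Q (x, y) / (Q (x, y) * (B l y powr (1 / l) / Z l) / marg_Y Q y)) =
        ln (marg_Y Q y) - ln (B l y) / l + ln (Z l)"
      using pos by (simp add: ln_div ln_mult ln_powr)
    show ?thesis unfolding e1 e2 e3 e4 using l by (simp add: field_simps)
  qed simp
  have "DXY Q - (1 - 1 / l) * DX Q =
    1 / l * KL Q (\<lambda>(x, y). marg_Y Q y * (P x * W x y powr l / B l y)) +
    KL Q (\<lambda>(x, y). Q (x, y) * (B l y powr (1 / l) / Z l) / marg_Y Q y) - (\<Sum>z\<in>UNIV. Q z * ln (Z l))"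
    unfolding DXY_def DX_def KL_def sum_distrib_left sum_subtractf[symmetric] sum.distrib[symmetric]
  proof (intro sum.cong refl)
    fix z :: "'x \<times> 'y"
    obtain x y where z: "z = (x, y)" by fastforce
    show "Q z * ln (Q z / PXY z) - (1 - 1 / l) * (Q z * ln (Q z / (case z of (x, y) \<Rightarrow> P x * marg_Y Q y))) =
      1 / l * (Q z * ln (Q z / (case z of (x, y) \<Rightarrow> marg_Y Q y * (P x * W x y powr l / B l y)))) +
      Q z * ln (Q z / (case z of (x, y) \<Rightarrow> Q (x, y) * (B l y powr (1 / l) / Z l) / marg_Y Q y)) - Q z * ln (Z l)"
      unfolding z case_prod_conv by (rule pt)
  qed
  also have "(\<Sum>z\<in>UNIV. Q z * ln (Z l)) = ln (Z l)"
    using Q by (simp add: is_pmf_def flip: sum_distrib_right)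
  finally show ?thesis .
qed

lemma variational_ge:
  assumes Q: "is_pmf Q" and ac: "\<And>x y. 0 < Q (x, y) \<Longrightarrow> 0 < P x \<and> 0 < W x y" and l: "0 < l"
  shows "- ln (Z l) \<le> DXY Q - (1 - 1 / l) * DX Q"
proof -
  have mQ: "0 \<le> marg_Y Q y" for y
    using Q unfolding marg_Y_def by (intro sum_nonneg) (auto simp: is_pmf_def)
  have "0 \<le> KL Q (\<lambda>(x, y). marg_Y Q y * (P x * W x y powr l / B l y))"
  proof (rule KL_nonneg[OF Q])
    have "marg_Y (\<lambda>(x, y). marg_Y Q y * (P x * W x y powr l / B l y)) y = marg_Y Q y * (B l y / B l y)" for y
      by (subst (1) marg_Y_def) (simp add: B_def flip: sum_distrib_left sum_divide_distrib)
    also have "\<And>y. marg_Y Q y * (B l y / B l y) \<le> marg_Y Q y" using mQ by simp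
    finally have "sum (\<lambda>(x, y). marg_Y Q y * (P x * W x y powr l / B l y)) UNIV \<le> sum (marg_Y Q) UNIV"
      unfolding sum_prod_marg by (intro sum_mono)
    then show "sum (\<lambda>(x, y). marg_Y Q y * (P x * W x y powr l / B l y)) UNIV \<le> 1"
      using Q unfolding sum_prod_marg[of Q, symmetric] by (simp add: is_pmf_def)
    show "0 \<le> (case a of (x, y) \<Rightarrow> marg_Y Q y * (P x * W x y powr l / B l y))" for a
      using mQ by (auto split: prod.split)
    show "0 < (case a of (x, y) \<Rightarrow> marg_Y Q y * (P x * W x y powr l / B l y))" if "0 < Q a" for a
    proof (cases a)
      case (Pair x y)
      then have "0 < Q (x, y)" using that by simp
      with Pair show ?thesis using ac[of x y] B_pos[of x y l] marg_pos[OF Q, of x y] by simp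
    qed
  qed
  moreover have "0 \<le> KL Q (\<lambda>(x, y). Q (x, y) * (B l y powr (1 / l) / Z l) / marg_Y Q y)"
  proof (rule KL_nonneg[OF Q])
    have "marg_Y (\<lambda>(x, y). Q (x, y) * (B l y powr (1 / l) / Z l) / marg_Y Q y) y
        = marg_Y Q y * (B l y powr (1 / l) / Z l) / marg_Y Q y" for y
      by (simp add: marg_Y_def flip: sum_distrib_right sum_divide_distrib)
    \<comment> \<open>Where \<open>marg_Y Q y = 0\<close> the quotient is 0 and the mass of
      \<open>tilt l\<close> at \<open>y\<close> is lost, hence only an inequality.\<close>
    also have "\<And>y. marg_Y Q y * (B l y powr (1 / l) / Z l) / marg_Y Q y \<le> marg_Y (tilt l) y"
      using Z_pos[of l] by (simp add: marg_tilt)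
    finally have "sum (\<lambda>(x, y). Q (x, y) * (B l y powr (1 / l) / Z l) / marg_Y Q y) UNIV \<le> sum (marg_Y (tilt l)) UNIV"
      unfolding sum_prod_marg by (intro sum_mono)
    then show "sum (\<lambda>(x, y). Q (x, y) * (B l y powr (1 / l) / Z l) / marg_Y Q y) UNIV \<le> 1"
      using pmf_tilt unfolding sum_prod_marg[of "tilt l", symmetric] by (simp add: is_pmf_def)
    show "0 \<le> (case a of (x, y) \<Rightarrow> Q (x, y) * (B l y powr (1 / l) / Z l) / marg_Y Q y)" for a
      using Z_pos[of l] mQ Q by (auto simp: is_pmf_def split: prod.split)
    show "0 < (case a of (x, y) \<Rightarrow> Q (x, y) * (B l y powr (1 / l) / Z l) / marg_Y Q y)" if "0 < Q a" for a
    proof (cases a)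
      case (Pair x y)
      then have "0 < Q (x, y)" using that by simp
      with Pair show ?thesis
        using ac[of x y] B_pos[of x y l] marg_pos[OF Q, of x y] Z_pos[of l] by simp
    qed
  qed
  ultimately show ?thesis using variational_identity[OF assms] l by simp
qed

text \<open>For \<open>Q = tilt l\<close> both reference measures in
  \<open>variational_identity\<close> coincide with \<open>Q\<close> on its support, so both
  remainders vanish.\<close>

lemma variational_eq:
  assumes l: "0 < l"
  shows "- ln (Z l) = DXY (tilt l) - (1 - 1 / l) * DX (tilt l)"
proof -
  have KL0: "KL (tilt l) r = 0" if "\<And>x y. 0 < tilt l (x, y) \<Longrightarrow> r (x, y) = tilt l (x, y)" for r
    unfolding KL_def
  proof (intro sum.neutral ballI)
    fix a show "tilt l a * ln (tilt l a / r a) = 0"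
      using that[of "fst a" "snd a"] tilt_nonneg[of l a] by (cases "tilt l a = 0") auto
  qed
  have "KL (tilt l) (\<lambda>(x, y). marg_Y (tilt l) y * (P x * W x y powr l / B l y)) = 0"
  proof (rule KL0)
    fix x y assume "0 < tilt l (x, y)"
    then have "0 < B l y" using B_pos by (auto simp: tilt_pos_iff)
    then show "(case (x, y) of (x, y) \<Rightarrow> marg_Y (tilt l) y * (P x * W x y powr l / B l y)) = tilt l (x, y)"
      unfolding case_prod_conv marg_tilt by (simp add: tilt_def powr_diff mult_ac)
  qed
  moreover have "KL (tilt l) (\<lambda>(x, y). tilt l (x, y) * (B l y powr (1 / l) / Z l) / marg_Y (tilt l) y) = 0"
    by (rule KL0) (use marg_pos[OF pmf_tilt] in \<open>force simp: marg_tilt\<close>)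
  ultimately show ?thesis
    using variational_identity[OF pmf_tilt _ l, of l] by (simp add: tilt_pos_iff)
qed

section \<open>Continuity in the order\<close>

lemma continuous_on_B: "continuous_on A (\<lambda>l. B l y)"
  unfolding B_def by (intro continuous_intros continuous_on_powr_exponent)

lemma continuous_on_B_powr:
  assumes "continuous_on A f"
  shows "continuous_on A (\<lambda>l. B l y powr f l)"
proof (cases "0 < PY y")
  case True
  then have "B l y \<noteq> 0" for l using B_pos_iff[of l y] by simp
  then show ?thesis using assms continuous_on_B by (intro continuous_on_powr) auto
next
  case False
  then have "B l y = 0" for l using B_pos_iff[of l y] B_nonneg[of l y] by (simp add: order_le_less)
  then show ?thesis by simp
qed

lemma continuous_on_Z: "continuous_on {1..2} Z"
  unfolding Z_def by (intro continuous_on_sum continuous_on_B_powr continuous_intros) auto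

text \<open>As the support of \<open>tilt l\<close> is independent of \<open>l\<close>, each summand
  is either built from positive continuous functions or identically 0.\<close>

lemma continuous_on_DX_tilt: "continuous_on {1..2} (\<lambda>l. DX (tilt l))"
proof -
  have "continuous_on {1..2} (\<lambda>l. tilt l (x, y) * ln (tilt l (x, y) / (P x * marg_Y (tilt l) y)))" for x y
  proof (cases "0 < P x \<and> 0 < W x y")
    case True
    then have t: "0 < tilt l (x, y)" for l by (simp add: tilt_pos_iff)
    have m: "0 < marg_Y (tilt l) y" for l using marg_pos[OF pmf_tilt t] .
    have c: "continuous_on {1..2} (\<lambda>l. tilt l (x, y))"
      unfolding tilt_def case_prod_conv
      by (intro continuous_intros continuous_on_powr_exponent continuous_on_B_powr continuous_on_Z)
         (use Z_pos in \<open>auto simp: less_imp_neq[symmetric]\<close>)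
    have c': "continuous_on {1..2} (\<lambda>l. marg_Y (tilt l) y)"
      unfolding marg_tilt
      by (intro continuous_intros continuous_on_B_powr continuous_on_Z)
         (use Z_pos in \<open>auto simp: less_imp_neq[symmetric]\<close>)
    show ?thesis
      using c c' m t True by (intro continuous_intros) (auto simp: less_imp_neq[symmetric])
  next
    case False
    then have "tilt l (x, y) = 0" for l using tilt_pos_iff[of l x y] tilt_nonneg[of l "(x, y)"] by auto
    then show ?thesis by simp
  qed
  then show ?thesis
    unfolding DX_def KL_def by (intro continuous_on_sum) (auto simp: case_prod_unfold)
qed

section \<open>Order one and the optimal order\<close>

lemma B_1: "B 1 y = PY y"
  by (simp add: B_def out_dist_def)

lemma Z_1: "Z 1 = 1"
  by (simp add: Z_def B_1 sum_PY)

lemma tilt_1: "tilt 1 = PXY"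
proof (intro ext, clarify)
  fix x y
  show "tilt 1 (x, y) = PXY (x, y)"
    using B_pos[of x y 1] P_nonneg[of x] W_nonneg[of x y]
    by (auto simp: tilt_def joint_def Z_1 order_le_less)
qed

text \<open>Turns the condition that the rate exceeds the mutual information into the hypothesis of
  \<open>saddle_point\<close>, in nats.\<close>

lemma DX_tilt_1: "DX (tilt 1) / ln b = mutual_info b P W"
proof -
  have "marg_Y PXY = PY" using marg_tilt[of 1] by (auto simp: tilt_1 B_1 Z_1)
  then have "rel_ent b PXY (\<lambda>(x, y). P x * PY y) = ereal (DX (tilt 1) / ln b)"
    using pmf_tilt[of 1] tilt_pos_iff[of 1] PY_pos
    unfolding DX_def tilt_1 by (subst rel_ent_eq_KL) (auto simp: less_imp_neq[symmetric])
  then show ?thesis by (simp add: mutual_info_def)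
qed

text \<open>At order 1 this shows that the rate is nonnegative, which keeps the rounding of the
  codebook size within a factor 2.\<close>

lemma DX_nonneg:
  assumes Q: "is_pmf Q" and ac: "\<And>x y. 0 < Q (x, y) \<Longrightarrow> 0 < P x"
  shows "0 \<le> DX Q"
  unfolding DX_def
proof (rule KL_nonneg[OF Q])
  have mQ: "0 \<le> marg_Y Q y" for y
    using Q unfolding marg_Y_def by (intro sum_nonneg) (auto simp: is_pmf_def)
  then show "0 \<le> (case a of (x, y) \<Rightarrow> P x * marg_Y Q y)" for a by (auto split: prod.split)
  have "marg_Y (\<lambda>(x, y). P x * marg_Y Q y) y = marg_Y Q y" for y
    by (subst (1) marg_Y_def) (simp add: sum_P flip: sum_distrib_right)
  then show "sum (\<lambda>(x, y). P x * marg_Y Q y) UNIV \<le> 1"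
    using Q unfolding sum_prod_marg[of "\<lambda>(x, y). P x * marg_Y Q y"]
    by (simp add: is_pmf_def flip: sum_prod_marg)
  show "0 < (case a of (x, y) \<Rightarrow> P x * marg_Y Q y)" if "0 < Q a" for a
    using that ac marg_pos[OF Q] by (cases a) auto
qed

text \<open>The tilted law at a maximiser is optimal: \<open>l'\<close> and \<open>tilt l\<close> in the variational
  inequality show that \<open>R - DX (tilt l)\<close> changes sign at the maximiser from above to below,
  so that it vanishes there in the interior, and is nonnegative if the maximiser is 2.\<close>

lemma saddle_point:
  assumes R: "DX (tilt 1) < R"
  obtains l where "l \<in> {1..2}"
    and "\<And>l'. l' \<in> {1..2} \<Longrightarrow> (1 - 1 / l') * R - ln (Z l') \<le> (1 - 1 / l) * R - ln (Z l)"
    and "(1 - 1 / l) * R - ln (Z l) = DXY (tilt l) + 1 / 2 * max 0 (R - DX (tilt l))"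
proof -
  define G where "G l = (1 - 1 / l) * R - ln (Z l)" for l
  define d where "d l = R - DX (tilt l)" for l
  have "continuous_on {1..2} G"
    unfolding G_def using Z_pos
    by (intro continuous_intros continuous_on_Z) (auto simp: less_imp_neq[symmetric])
  then obtain c where c: "c \<in> {1..2}" and max: "\<And>l. l \<in> {1..2} \<Longrightarrow> G l \<le> G c"
    using continuous_attains_sup[of "{1..2}" G] by auto
  have cont: "continuous_on {1..2} d"
    unfolding d_def by (intro continuous_intros continuous_on_DX_tilt)
  \<comment> \<open>An envelope inequality instead of a derivative of \<open>G\<close>: with
    \<open>tilt l\<close> as competitor at order \<open>c\<close>, the nonnegative difference
    \<open>G c - G l\<close> is at most this product.\<close>
  have sgn: "0 \<le> (1 / l - 1 / c) * d l" if l: "l \<in> {1..2}" for l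
  proof -
    have "- ln (Z c) \<le> DXY (tilt l) - (1 - 1 / c) * DX (tilt l)"
      using c by (intro variational_ge pmf_tilt) (auto simp: tilt_pos_iff)
    moreover have "- ln (Z l) = DXY (tilt l) - (1 - 1 / l) * DX (tilt l)"
      using l by (intro variational_eq) auto
    moreover have "G l \<le> G c" using max l .
    ultimately show ?thesis by (simp add: G_def d_def algebra_simps)
  qed
  have above: "d c \<le> 0" if "c < 2"
  proof (rule continuous_le_on_closure[where S = "{c<..<2}" and f = d])
    show "continuous_on (closure {c<..<2}) d"
      using c that by (intro continuous_on_subset[OF cont]) auto
    show "c \<in> closure {c<..<2}" using that by simp
    show "d l \<le> 0" if "l \<in> {c<..<2}" for l
    proof -
      have "1 / l < 1 / c" using that c by (auto intro!: divide_strict_left_mono)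
      then show ?thesis using sgn[of l] that c by (auto simp: zero_le_mult_iff)
    qed
  qed
  have below: "0 \<le> d c" if "1 < c"
  proof (rule continuous_ge_on_closure[where S = "{1<..<c}" and f = d])
    show "continuous_on (closure {1<..<c}) d"
      using c that by (intro continuous_on_subset[OF cont]) auto
    show "c \<in> closure {1<..<c}" using that by simp
    show "0 \<le> d l" if "l \<in> {1<..<c}" for l
    proof -
      have "1 / c < 1 / l" using that c by (auto intro!: divide_strict_left_mono)
      then show ?thesis using sgn[of l] that c by (auto simp: zero_le_mult_iff)
    qed
  qed
  \<comment> \<open>At \<open>c = 1\<close> the bound \<open>above\<close> would contradict
    \<open>d 1 > 0\<close>, which is the rate condition.\<close>
  have "c \<noteq> 1" using above R by (auto simp: d_def)
  then have "0 \<le> d c" using below c by simp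
  \<comment> \<open>At \<open>c = 2\<close> the coefficient \<open>1 - 1 / c\<close> is exactly the
    1/2 in front of the positive part; at interior maximisers \<open>d c = 0\<close>, so the
    coefficient is irrelevant.\<close>
  have "G c = DXY (tilt c) + 1 / 2 * max 0 (d c)"
  proof (cases "c = 2")
    case True
    then show ?thesis
      using \<open>0 \<le> d c\<close> variational_eq[of 2] by (simp add: G_def d_def algebra_simps)
  next
    case False
    then have "d c = 0" using above c \<open>0 \<le> d c\<close> by simp
    then show ?thesis using variational_eq[of c] c by (simp add: G_def d_def)
  qed
  then show thesis using that[OF c] max unfolding G_def d_def by blast
qed

text \<open>Non-degeneracy enters here: typical likelihoods exceed the output probability at an
  exponential rate. For each \<open>y\<close>, \<open>powr_mult_ln_ge\<close> bounds the mean of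
  \<open>u powr l * ln u\<close>, \<open>u = W x y / PY y\<close>, below by the mean of
  \<open>u - 1\<close>, which is 0, strictly at a letter where \<open>W x0\<close> and
  \<open>PY\<close> differ.\<close>

lemma mean_log_likelihood_pos:
  assumes l: "1 \<le> l" and "0 < P x0" "W x0 \<noteq> PY"
  shows "0 < (\<Sum>(x, y)\<in>UNIV. tilt l (x, y) * ln (W x y / PY y))"
proof -
  define c where "c y = B l y powr (1 / l - 1) / Z l" for y
  define inner where "inner y = (\<Sum>x\<in>UNIV. P x * (W x y powr l * ln (W x y / PY y)))" for y
  have c0: "0 \<le> c y" for y using Z_pos[of l] by (simp add: c_def)
  have cpos: "0 < c y" if "0 < PY y" for y
    using Z_pos[of l] that B_pos_iff[of l y] by (simp add: c_def)
  have cz: "c y = 0" if "PY y = 0" for y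
    using that B_pos_iff[of l y] B_nonneg[of l y] by (simp add: c_def order_le_less)
  have inner_eq: "inner y = PY y powr l * (\<Sum>x\<in>UNIV. P x * ((W x y / PY y) powr l * ln (W x y / PY y)))"
    if "0 < PY y" for y
    using that unfolding inner_def sum_distrib_left
    by (intro sum.cong) (auto simp: powr_divide)
  have zero: "(\<Sum>x\<in>UNIV. P x * (W x y / PY y - 1)) = 0" if "0 < PY y" for y
  proof -
    have "(\<Sum>x\<in>UNIV. P x * (W x y / PY y - 1)) = (\<Sum>x\<in>UNIV. P x * W x y) / PY y - sum P UNIV"
      by (simp add: right_diff_distrib sum_subtractf sum_divide_distrib)
    then show ?thesis using that by (simp add: sum_P flip: out_dist_def)
  qed
  have inner0: "0 \<le> inner y" if "0 < PY y" for y
  proof -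
    have "(\<Sum>x\<in>UNIV. P x * (W x y / PY y - 1)) \<le>
        (\<Sum>x\<in>UNIV. P x * ((W x y / PY y) powr l * ln (W x y / PY y)))"
      using l by (intro sum_mono mult_left_mono powr_mult_ln_ge) auto
    then show ?thesis using that by (simp add: inner_eq zero)
  qed
  obtain y0 where y0: "W x0 y0 \<noteq> PY y0" using assms by auto
  \<comment> \<open>If \<open>PY y0\<close> were 0, then \<open>W x0 y0\<close> would be 0 as well
    because \<open>0 < P x0\<close>, and the two could not differ.\<close>
  have PY0: "0 < PY y0"
    using y0 PY_pos[of x0 y0] assms W_nonneg[of x0 y0] PY_nonneg[of y0] by (auto simp: order_le_less)
  have inner_pos: "0 < inner y0"
  proof -
    have "(\<Sum>x\<in>UNIV. P x * (W x y0 / PY y0 - 1)) <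
        (\<Sum>x\<in>UNIV. P x * ((W x y0 / PY y0) powr l * ln (W x y0 / PY y0)))"
    proof (rule sum_strict_mono_ex1)
      show "\<forall>x\<in>UNIV. P x * (W x y0 / PY y0 - 1) \<le> P x * ((W x y0 / PY y0) powr l * ln (W x y0 / PY y0))"
        using l by (intro ballI mult_left_mono powr_mult_ln_ge) auto
      show "\<exists>x\<in>UNIV. P x * (W x y0 / PY y0 - 1) < P x * ((W x y0 / PY y0) powr l * ln (W x y0 / PY y0))"
        using l y0 PY0 assms by (intro bexI[of _ x0] mult_strict_left_mono powr_mult_ln_ge(2)) auto
    qed auto
    then show ?thesis using PY0 by (simp add: inner_eq zero)
  qed
  have "(\<Sum>(x, y)\<in>UNIV. tilt l (x, y) * ln (W x y / PY y)) =
      (\<Sum>y\<in>UNIV. \<Sum>x\<in>UNIV. tilt l (x, y) * ln (W x y / PY y))"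
    by (subst sum.swap) (simp add: sum.cartesian_product flip: UNIV_Times_UNIV)
  also have "\<dots> = (\<Sum>y\<in>UNIV. c y * inner y)"
    by (intro sum.cong refl) (simp add: tilt_def c_def inner_def sum_distrib_left mult_ac)
  also have "0 < \<dots>"
  proof (rule sum_pos2[where i = y0])
    show "0 < c y0 * inner y0" using cpos[OF PY0] inner_pos by simp
    show "0 \<le> c y * inner y" for y
      using inner0[of y] c0[of y] cz[of y] PY_nonneg[of y] by (cases "PY y = 0") (auto simp: order_le_less)
  qed auto
  finally show ?thesis .
qed

end

section \<open>Block length asymptotics\<close>

lemma sum_seqs_prod:
  fixes g :: "'a::finite \<Rightarrow> real"
  shows "(\<Sum>x\<in>seqs n. \<Prod>i<n. g (x i)) = sum g UNIV ^ n"
  unfolding seqs_def by (subst prod_sum_PiE[symmetric]) auto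

lemma finite_seqs: "finite (seqs n :: (nat \<Rightarrow> 'a::finite) set)"
  unfolding seqs_def by (intro finite_PiE) auto

text \<open>Splits a word of pairs into a pair of words; the restrictions supply the value
  \<open>undefined\<close> beyond \<open>n\<close> that membership in \<open>seqs n\<close>
  demands.\<close>

lemma sum_seqs_pair:
  fixes F :: "(nat \<Rightarrow> 'a::finite) \<Rightarrow> (nat \<Rightarrow> 'b::finite) \<Rightarrow> real"
  shows "(\<Sum>z\<in>seqs n. F (\<lambda>i\<in>{..<n}. fst (z i)) (\<lambda>i\<in>{..<n}. snd (z i))) = (\<Sum>y\<in>seqs n. \<Sum>x\<in>seqs n. F x y)"
proof -
  have "(\<Sum>z\<in>seqs n. F (\<lambda>i\<in>{..<n}. fst (z i)) (\<lambda>i\<in>{..<n}. snd (z i))) =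
      (\<Sum>(x, y)\<in>seqs n \<times> seqs n. F x y)"
    by (rule sum.reindex_bij_witness[where
          i = "\<lambda>(x, y). \<lambda>i\<in>{..<n}. (x i, y i)"
          and j = "\<lambda>z. (\<lambda>i\<in>{..<n}. fst (z i), \<lambda>i\<in>{..<n}. snd (z i))"])
       (auto simp: seqs_def PiE_def extensional_def restrict_def fun_eq_iff)
  also have "\<dots> = (\<Sum>y\<in>seqs n. \<Sum>x\<in>seqs n. F x y)"
    by (subst sum.swap) (simp add: sum.cartesian_product)
  finally show ?thesis .
qed

lemma finite_prob_iid: "finite_prob (iid P n) (seqs n)" if "is_pmf P" for P :: "'a::finite \<Rightarrow> real"
proof
  show "sum (iid P n) (seqs n) = 1"
    using that sum_seqs_prod[where g = P] by (simp add: iid_def[abs_def] is_pmf_def)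
  show "0 \<le> iid P n x" for x
    using that unfolding iid_def by (intro prod_nonneg) (auto simp: is_pmf_def)
qed (rule finite_seqs)

lemma chebyshev_iid:
  fixes Q :: "'a::finite \<Rightarrow> real" and f :: "'a \<Rightarrow> real"
  assumes Q: "is_pmf Q" and e: "0 < e" and n: "0 < n"
  defines "m \<equiv> \<Sum>a\<in>UNIV. Q a * f a"
  shows "(\<Sum>z\<in>{z \<in> seqs n. n * e < \<bar>(\<Sum>i<n. f (z i)) - n * m\<bar>}. iid Q n z)
    \<le> (\<Sum>a\<in>UNIV. Q a * (f a - m)\<^sup>2) / (n * e\<^sup>2)"
proof -
  interpret finite_prob Q UNIV using Q by unfold_locales (auto simp: is_pmf_def)
  define h where "h z = (\<Sum>i<n. f (z i) - m)" for z :: "nat \<Rightarrow> 'a"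
  have h: "(\<Sum>i<n. f (z i)) - n * m = h z" for z by (simp add: h_def sum_subtractf)
  have iid0: "0 \<le> iid Q n z" for z
    using Q unfolding iid_def by (intro prod_nonneg) (auto simp: is_pmf_def)
  have "(\<Sum>z\<in>{z \<in> seqs n. n * e < \<bar>h z\<bar>}. iid Q n z)
      \<le> (\<Sum>z\<in>{z \<in> seqs n. n * e < \<bar>h z\<bar>}. iid Q n z * ((h z)\<^sup>2 / (n * e)\<^sup>2))"
  proof (rule sum_mono)
    fix z assume "z \<in> {z \<in> seqs n. n * e < \<bar>h z\<bar>}"
    then have "(n * e)\<^sup>2 \<le> \<bar>h z\<bar>\<^sup>2" using e by (intro power_mono) auto
    then have "1 \<le> (h z)\<^sup>2 / (n * e)\<^sup>2" using e n by simp
    then show "iid Q n z \<le> iid Q n z * ((h z)\<^sup>2 / (n * e)\<^sup>2)"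
      using mult_left_mono[OF _ iid0[of z], of 1 "(h z)\<^sup>2 / (n * e)\<^sup>2"] by simp
  qed
  also have "\<dots> \<le> (\<Sum>z\<in>seqs n. iid Q n z * ((h z)\<^sup>2 / (n * e)\<^sup>2))"
    using iid0 by (intro sum_mono2 finite_seqs) auto
  also have "\<dots> = EM n (\<lambda>z. (h z)\<^sup>2) / (n * e)\<^sup>2"
    by (simp add: iid_expect_def iid_def seqs_def sum_divide_distrib)
  also have "EM n (\<lambda>z. (h z)\<^sup>2) = n * (\<Sum>a\<in>UNIV. Q a * (f a - m)\<^sup>2)"
    unfolding h_def
    by (rule iid_expect_square) (simp add: right_diff_distrib sum_subtractf sum_p_mult m_def)
  also have "n * (\<Sum>a\<in>UNIV. Q a * (f a - m)\<^sup>2) / (n * e)\<^sup>2 = (\<Sum>a\<in>UNIV. Q a * (f a - m)\<^sup>2) / (n * e\<^sup>2)"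
    using n by (simp add: power2_eq_square)
  finally show ?thesis by (simp add: h)
qed

section \<open>Upper and lower bounds on the expected distance at block length n\<close>

context dmc
begin

lemma mem_chan_nonneg: "0 \<le> mem_chan W n x y"
  unfolding mem_chan_def by (intro prod_nonneg) auto

lemma mean_mem_chan: "(\<Sum>x\<in>seqs n. iid P n x * mem_chan W n x y) = iid PY n y"
proof -
  have "(\<Sum>x\<in>seqs n. iid P n x * mem_chan W n x y) = (\<Sum>x\<in>PiE {..<n} (\<lambda>_. UNIV). \<Prod>i<n. P (x i) * W (x i) (y i))"
    by (simp add: iid_def mem_chan_def seqs_def prod.distrib)
  also have "\<dots> = (\<Prod>i<n. \<Sum>x\<in>UNIV. P x * W x (y i))"
    by (subst prod_sum_PiE) auto
  finally show ?thesis by (simp add: iid_def out_dist_def)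
qed

lemma moment_mem_chan:
  "(\<Sum>x\<in>seqs n. iid P n x * mem_chan W n x y powr l) = (\<Prod>i<n. B l (y i))"
proof -
  have "mem_chan W n x y powr l = (\<Prod>i<n. W (x i) (y i) powr l)" for x
    unfolding mem_chan_def by (rule prod_powr_distrib)
  then have "(\<Sum>x\<in>seqs n. iid P n x * mem_chan W n x y powr l) =
      (\<Sum>x\<in>PiE {..<n} (\<lambda>_. UNIV). \<Prod>i<n. P (x i) * W (x i) (y i) powr l)"
    by (simp add: iid_def seqs_def prod.distrib)
  also have "\<dots> = (\<Prod>i<n. \<Sum>x\<in>UNIV. P x * W x (y i) powr l)"
    by (subst prod_sum_PiE) auto
  finally show ?thesis by (simp add: B_def)
qed

text \<open>For a fixed output word only \<open>M\<close> independent likelihoods with mean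
  \<open>iid PY n y\<close> matter, so the deviation bounds apply word by word.\<close>

lemma expected_tv_eq:
  assumes "0 < M"
  shows "expected_tv P W n M = 1 / M * (\<Sum>y\<in>seqs n.
    iid_expect (iid P n) (seqs n) M (\<lambda>c. \<bar>\<Sum>j<M. mem_chan W n (c j) y - iid PY n y\<bar>))"
proof -
  have *: "\<bar>codebook_output W n M c y - iid PY n y\<bar> =
      1 / M * \<bar>\<Sum>j<M. mem_chan W n (c j) y - iid PY n y\<bar>" for c y
  proof -
    have "codebook_output W n M c y - iid PY n y =
        1 / M * (\<Sum>j<M. mem_chan W n (c j) y - iid PY n y)"
      using assms by (simp add: codebook_output_def sum_subtractf right_diff_distrib)
    then show ?thesis by (simp add: abs_mult)
  qed
  show ?thesis
    unfolding expected_tv_def * iid_expect_sum[symmetric] iid_expect_cmult[symmetric]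
    by (simp only: iid_expect_def sum_distrib_left)
qed

text \<open>The moments of order \<open>l\<close> factor over letters, so after the power
  \<open>1 / l\<close> they sum to exactly \<open>Z l ^ n\<close>. The codebook size enters as
  \<open>M powr (1 / l - 1)\<close>, which does not increase with \<open>M\<close>, so a lower bound
  on \<open>M\<close> suffices.\<close>

lemma expected_tv_le:
  fixes R :: real
  assumes l: "1 \<le> l" "l \<le> 2" and M: "exp (n * R) \<le> M"
  shows "expected_tv P W n M \<le> 3 * exp (- real n * ((1 - 1 / l) * R - ln (Z l)))"
proof -
  interpret finite_prob "iid P n" "seqs n" by (rule finite_prob_iid[OF pmf_P])
  have M0: "0 < real M" using M by (meson exp_gt_zero less_le_trans)
  have "expected_tv P W n M \<le> 1 / M * (\<Sum>y\<in>seqs n. 3 * (M * (\<Prod>i<n. B l (y i))) powr (1 / l))"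
    using M0 unfolding expected_tv_eq[OF M0[unfolded of_nat_0_less_iff]]
      moment_mem_chan[symmetric] mean_mem_chan[symmetric]
    by (intro mult_left_mono sum_mono iid_expect_dev_le l mem_chan_nonneg) auto
  also have "\<dots> = 3 * (1 / M * M powr (1 / l)) * (\<Sum>y\<in>seqs n. \<Prod>i<n. B l (y i) powr (1 / l))"
    by (simp add: powr_mult prod_powr_distrib sum_distrib_left prod_nonneg mult_ac)
  also have "(\<Sum>y\<in>seqs n. \<Prod>i<n. B l (y i) powr (1 / l)) = exp (n * ln (Z l))"
    using Z_pos[of l] sum_seqs_prod[where g = "\<lambda>y. B l y powr (1 / l)"]
    by (simp add: exp_of_nat_mult flip: Z_def)
  also have "1 / M * M powr (1 / l) = M powr (1 / l - 1)"
    using M0 by (simp add: powr_diff)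
  also have "\<dots> \<le> exp (n * R) powr (1 / l - 1)"
    using l M by (intro powr_mono2') auto
  finally have "expected_tv P W n M \<le> 3 * exp (n * R) powr (1 / l - 1) * exp (n * ln (Z l))"
    by simp
  also have "\<dots> = 3 * exp (- real n * ((1 - 1 / l) * R - ln (Z l)))"
    by (simp add: powr_def algebra_simps flip: exp_add)
  finally show ?thesis .
qed

text \<open>\<open>f1\<close> controls the joint probability of typical pairs, \<open>f2\<close> the
  probability that a codeword is typical with \<open>y\<close>, and \<open>f3\<close> the ratio of
  the likelihood to the output probability. The slack \<open>3 / 2 * e\<close> is \<open>e\<close>
  from \<open>f1\<close> plus \<open>e / 2\<close> from \<open>f2\<close> under the square root; the
  constant is 3/4 from \<open>iid_expect_dev_ge\<close>, times 1/2 for the typical mass, over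
  \<open>sqrt 7\<close>.\<close>

lemma expected_tv_ge_typical:
  fixes l e R :: real and n M :: nat
  defines "Q \<equiv> tilt l"
  defines "f1 \<equiv> \<lambda>z. ln (Q z / PXY z)"
    and "f2 \<equiv> \<lambda>(x, y). ln (Q (x, y) / (P x * marg_Y Q y))"
    and "f3 \<equiv> \<lambda>(x, y). ln (W x y / PY y)"
  defines "m3 \<equiv> \<Sum>z\<in>UNIV. Q z * f3 z"
  assumes e: "0 < e" and n: "0 < n" and M: "0 < M" "M \<le> 2 * exp (n * R)"
    and V: "((\<Sum>z\<in>UNIV. Q z * (f1 z - DXY Q)\<^sup>2) + (\<Sum>z\<in>UNIV. Q z * (f2 z - DX Q)\<^sup>2)
      + (\<Sum>z\<in>UNIV. Q z * (f3 z - m3)\<^sup>2)) / (n * e\<^sup>2) \<le> 1 / 2"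
    and big: "ln 4 \<le> n * (m3 - e)"
  shows "3 / (8 * sqrt 7) * exp (- real n * (DXY Q + 1 / 2 * max 0 (R - DX Q) + 3 / 2 * e)) \<le> expected_tv P W n M"
proof -
  interpret finite_prob "iid P n" "seqs n" by (rule finite_prob_iid[OF pmf_P])
  have pmf_Q: "is_pmf Q" unfolding Q_def by (rule pmf_tilt)
  have Q0: "0 \<le> Q z" for z using pmf_Q by (cases z) (auto simp: is_pmf_def)
  have Qpos: "0 < Q (x, y) \<Longrightarrow> 0 < P x \<and> 0 < W x y" for x y by (simp add: Q_def tilt_pos_iff)
  have m1: "DXY Q = (\<Sum>z\<in>UNIV. Q z * f1 z)"
    unfolding DXY_def KL_def f1_def ..
  have m2: "DX Q = (\<Sum>z\<in>UNIV. Q z * f2 z)"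
    unfolding DX_def KL_def f2_def by (simp add: case_prod_unfold)
  define dev where "dev f m z \<longleftrightarrow> n * e < \<bar>(\<Sum>i<n. f (z i)) - n * m\<bar>" for f :: "'x \<times> 'y \<Rightarrow> real" and m :: real and z :: "nat \<Rightarrow> 'x \<times> 'y"
  \<comment> \<open>The logarithms are meaningful only where \<open>Q\<close> is positive; words
    leaving this support have probability 0 under \<open>Q\<close>.\<close>
  define supp where "supp z \<longleftrightarrow> (\<forall>i<n. 0 < Q (z i))" for z :: "nat \<Rightarrow> 'x \<times> 'y"
  define good where "good z \<longleftrightarrow> supp z \<and> \<not> dev f1 (DXY Q) z \<and> \<not> dev f2 (DX Q) z \<and> \<not> dev f3 m3 z" for z
  define T where "T y = {x \<in> seqs n. good (\<lambda>i. (x i, y i))}" for y :: "nat \<Rightarrow> 'y"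
  define A where "A y = (\<Sum>x\<in>T y. iid P n x * mem_chan W n x y)" for y
  define K where "K = sqrt 7 * exp (n * (max 0 (R - DX Q) + e) / 2)"
  have iidQ0: "0 \<le> iid Q n z" for z unfolding iid_def by (intro prod_nonneg) (simp add: Q0)
  have iidP0: "0 \<le> iid P n x" for x unfolding iid_def by (intro prod_nonneg) simp

  have mass: "1 / 2 \<le> (\<Sum>z\<in>{z \<in> seqs n. good z}. iid Q n z)"
  proof -
    have "1 = (\<Sum>z\<in>seqs n. iid Q n z)"
      using finite_prob_iid[OF pmf_Q] by (simp add: finite_prob_def)
    also have "\<dots> \<le> (\<Sum>z\<in>seqs n. (if good z then iid Q n z else 0) + (if dev f1 (DXY Q) z then iid Q n z else 0)
        + (if dev f2 (DX Q) z then iid Q n z else 0) + (if dev f3 m3 z then iid Q n z else 0))"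
    proof (rule sum_mono)
      fix z :: "nat \<Rightarrow> 'x \<times> 'y"
      have "iid Q n z = 0" if ns: "\<not> supp z"
      proof -
        obtain i where "i < n" "\<not> 0 < Q (z i)"
          using ns unfolding supp_def by auto
        moreover from this have "Q (z i) = 0" using Q0[of "z i"] by linarith
        ultimately show ?thesis unfolding iid_def by (intro prod_zero) auto
      qed
      then show "iid Q n z \<le> (if good z then iid Q n z else 0) + (if dev f1 (DXY Q) z then iid Q n z else 0)
        + (if dev f2 (DX Q) z then iid Q n z else 0) + (if dev f3 m3 z then iid Q n z else 0)"
        using iidQ0[of z] by (auto simp: good_def)
    qed
    also have "\<dots> = (\<Sum>z\<in>{z \<in> seqs n. good z}. iid Q n z) + ((\<Sum>z\<in>{z \<in> seqs n. dev f1 (DXY Q) z}. iid Q n z)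
        + (\<Sum>z\<in>{z \<in> seqs n. dev f2 (DX Q) z}. iid Q n z) + (\<Sum>z\<in>{z \<in> seqs n. dev f3 m3 z}. iid Q n z))"
      by (simp add: sum.distrib sum.inter_filter finite_seqs)
    also have "(\<Sum>z\<in>{z \<in> seqs n. dev f1 (DXY Q) z}. iid Q n z)
        + (\<Sum>z\<in>{z \<in> seqs n. dev f2 (DX Q) z}. iid Q n z) + (\<Sum>z\<in>{z \<in> seqs n. dev f3 m3 z}. iid Q n z)
      \<le> (\<Sum>z\<in>UNIV. Q z * (f1 z - DXY Q)\<^sup>2) / (n * e\<^sup>2) + (\<Sum>z\<in>UNIV. Q z * (f2 z - DX Q)\<^sup>2) / (n * e\<^sup>2)
        + (\<Sum>z\<in>UNIV. Q z * (f3 z - m3)\<^sup>2) / (n * e\<^sup>2)"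
      unfolding dev_def m1 m2 m3_def by (intro add_mono chebyshev_iid pmf_Q e n)
    also have "\<dots> \<le> 1 / 2" using V by (simp add: add_divide_distrib)
    finally show ?thesis by simp
  qed

  have prod_exp: "(\<Prod>i<n. g i) = exp (\<Sum>i<n. ln (g i))" if "\<And>i. i < n \<Longrightarrow> 0 < g i" for g :: "nat \<Rightarrow> real"
    using that by (simp add: exp_sum)
  \<comment> \<open>One side of each deviation bound, for \<open>f1\<close>, \<open>f2\<close>,
    \<open>f3\<close> in this order; the factor 4 is what \<open>iid_expect_dev_ge\<close> asks
    for.\<close>
  have typical: "iid Q n (\<lambda>i. (x i, y i)) * exp (- real n * (DXY Q + e)) \<le> iid P n x * mem_chan W n x y"
      "iid P n x \<le> exp (- real n * (DX Q - e)) * (\<Prod>i<n. Q (x i, y i) / marg_Y Q (y i))"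
      "4 * iid PY n y \<le> mem_chan W n x y" if x: "x \<in> T y" for x y
  proof -
    have g: "good (\<lambda>i. (x i, y i))" using x by (simp add: T_def)
    have pos: "0 < Q (x i, y i)" "0 < P (x i)" "0 < W (x i) (y i)" "0 < marg_Y Q (y i)" "0 < PY (y i)" if "i < n" for i
      using g that Qpos[of "x i" "y i"] marg_pos[OF pmf_Q, of "x i" "y i"] PY_pos[of "x i" "y i"]
      by (auto simp: good_def supp_def)
    then have nz: "P (x i) \<noteq> 0" "W (x i) (y i) \<noteq> 0" "marg_Y Q (y i) \<noteq> 0" "PY (y i) \<noteq> 0" if "i < n" for i
      using that by (metis less_irrefl)+
    have s1: "(\<Sum>i<n. f1 (x i, y i)) \<le> n * (DXY Q + e)"
      and s2: "n * (DX Q - e) \<le> (\<Sum>i<n. f2 (x i, y i))"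
      and s3: "n * (m3 - e) \<le> (\<Sum>i<n. f3 (x i, y i))"
      using g by (auto simp: good_def dev_def algebra_simps abs_le_iff not_less)
    have shift: "exp (S - n * a) = exp S * exp (- real n * a)" for S a :: real
      by (simp flip: exp_add)
    have "iid Q n (\<lambda>i. (x i, y i)) = (\<Prod>i<n. Q (x i, y i) / PXY (x i, y i)) * (iid P n x * mem_chan W n x y)"
      unfolding iid_def mem_chan_def prod.distrib[symmetric]
      by (intro prod.cong refl) (use nz in \<open>simp add: joint_def\<close>)
    also have "(\<Prod>i<n. Q (x i, y i) / PXY (x i, y i)) = exp (\<Sum>i<n. f1 (x i, y i))"
      unfolding f1_def by (rule prod_exp) (use pos in \<open>simp add: joint_def\<close>)
    finally have "iid Q n (\<lambda>i. (x i, y i)) * exp (- real n * (DXY Q + e)) =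
        exp ((\<Sum>i<n. f1 (x i, y i)) - n * (DXY Q + e)) * (iid P n x * mem_chan W n x y)"
      by (simp add: shift)
    also have "\<dots> \<le> 1 * (iid P n x * mem_chan W n x y)"
      using s1 iidP0 mem_chan_nonneg by (intro mult_right_mono mult_nonneg_nonneg) auto
    finally show "iid Q n (\<lambda>i. (x i, y i)) * exp (- real n * (DXY Q + e)) \<le> iid P n x * mem_chan W n x y" by simp
    have "(\<Prod>i<n. Q (x i, y i) / marg_Y Q (y i)) = (\<Prod>i<n. Q (x i, y i) / (P (x i) * marg_Y Q (y i))) * iid P n x"
      unfolding iid_def prod.distrib[symmetric]
      by (intro prod.cong refl) (use nz in \<open>simp add: field_simps\<close>)
    also have "(\<Prod>i<n. Q (x i, y i) / (P (x i) * marg_Y Q (y i))) = exp (\<Sum>i<n. f2 (x i, y i))"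
      unfolding f2_def case_prod_conv by (rule prod_exp) (use pos in simp)
    finally have "exp (- real n * (DX Q - e)) * (\<Prod>i<n. Q (x i, y i) / marg_Y Q (y i)) =
        exp ((\<Sum>i<n. f2 (x i, y i)) - n * (DX Q - e)) * iid P n x"
      by (simp add: shift)
    also have "\<dots> \<ge> 1 * iid P n x"
      using s2 iidP0 by (intro mult_right_mono) auto
    finally show "iid P n x \<le> exp (- real n * (DX Q - e)) * (\<Prod>i<n. Q (x i, y i) / marg_Y Q (y i))" by simp
    have "mem_chan W n x y = (\<Prod>i<n. W (x i) (y i) / PY (y i)) * iid PY n y"
      unfolding iid_def mem_chan_def prod.distrib[symmetric]
      by (intro prod.cong refl) (use nz in simp)
    also have "(\<Prod>i<n. W (x i) (y i) / PY (y i)) = exp (\<Sum>i<n. f3 (x i, y i))"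
      unfolding f3_def case_prod_conv by (rule prod_exp) (use pos in simp)
    also have "exp (\<Sum>i<n. f3 (x i, y i)) * iid PY n y \<ge> exp (ln 4) * iid PY n y"
      using s3 big
      by (intro mult_right_mono) (auto simp: iid_def prod_nonneg simp del: exp_ln exp_ln_iff)
    finally show "4 * iid PY n y \<le> mem_chan W n x y" by simp
  qed

  have A0: "0 \<le> A y" for y
    unfolding A_def by (intro sum_nonneg mult_nonneg_nonneg iidP0 mem_chan_nonneg)
  \<comment> \<open>The product of \<open>Q / marg_Y Q\<close> is the conditional law of
    \<open>x\<close> given \<open>y\<close> under \<open>Q\<close>; over all words it sums to at
    most 1.\<close>
  have pT: "sum (iid P n) (T y) \<le> exp (- real n * (DX Q - e))" for y
  proof -
    have "sum (iid P n) (T y) \<le> (\<Sum>x\<in>T y. exp (- real n * (DX Q - e)) * (\<Prod>i<n. Q (x i, y i) / marg_Y Q (y i)))"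
      by (intro sum_mono typical)
    also have "\<dots> \<le> (\<Sum>x\<in>seqs n. exp (- real n * (DX Q - e)) * (\<Prod>i<n. Q (x i, y i) / marg_Y Q (y i)))"
      using Q0 by (intro sum_mono2 finite_seqs)
        (auto simp: T_def marg_Y_def intro!: mult_nonneg_nonneg prod_nonneg divide_nonneg_nonneg sum_nonneg)
    also have "\<dots> = exp (- real n * (DX Q - e)) * (\<Prod>i<n. \<Sum>x\<in>UNIV. Q (x, y i) / marg_Y Q (y i))"
      by (subst prod_sum_PiE) (auto simp: seqs_def sum_distrib_left)
    also have "(\<Prod>i<n. \<Sum>x\<in>UNIV. Q (x, y i) / marg_Y Q (y i)) \<le> 1"
      using Q0 by (intro prod_le_1) (auto simp flip: sum_divide_distrib simp: marg_Y_def sum_nonneg)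
    finally show ?thesis by simp
  qed
  \<comment> \<open>The codebook size contributes \<open>3 * 2 = 6\<close>, and the summand 1 is
    absorbed since the exponent is nonnegative: hence 7. The positive part of the exponent arises
    here.\<close>
  have sqrt_le: "sqrt (1 + 3 * (M * sum (iid P n) (T y))) \<le> K" for y
  proof -
    have "M * sum (iid P n) (T y) \<le> 2 * exp (n * R) * exp (- real n * (DX Q - e))"
      using M pT iidP0 by (intro mult_mono) (auto intro: sum_nonneg)
    also have "\<dots> = 2 * exp (n * (R - DX Q + e))" by (simp add: algebra_simps flip: exp_add)
    also have "\<dots> \<le> 2 * exp (n * (max 0 (R - DX Q) + e))" by (simp add: mult_left_mono)
    finally have "1 + 3 * (M * sum (iid P n) (T y)) \<le> 1 + 6 * exp (n * (max 0 (R - DX Q) + e))" by simp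
    also have "\<dots> \<le> 7 * exp (n * (max 0 (R - DX Q) + e))"
      using e by simp
    finally have "sqrt (1 + 3 * (M * sum (iid P n) (T y))) \<le> sqrt (7 * exp (n * (max 0 (R - DX Q) + e)))"
      by simp
    also have "\<dots> = K"
      unfolding K_def real_sqrt_mult by (simp add: real_sqrt_unique exp_double[symmetric] flip: exp_of_nat_mult)
    finally show ?thesis .
  qed

  \<comment> \<open>The words \<open>\<lambda>i. (x i, y i)\<close> are not restricted to
    \<open>{..<n}\<close>, so they differ from elements of \<open>seqs n\<close> beyond
    \<open>n\<close>, where neither predicate nor probability looks.\<close>
  have agree: "good z' = good z" "iid Q n z' = iid Q n z" if z: "\<And>i. i < n \<Longrightarrow> z' i = z i" for z z'
  proof -
    have "(\<Sum>i<n. f (z' i)) = (\<Sum>i<n. f (z i))" for f :: "'x \<times> 'y \<Rightarrow> real"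
      using z by (intro sum.cong) auto
    then show "good z' = good z" using z by (simp add: good_def supp_def dev_def)
    show "iid Q n z' = iid Q n z" unfolding iid_def using z by (intro prod.cong) auto
  qed
  have "1 / 2 \<le> (\<Sum>z\<in>seqs n. if good z then iid Q n z else 0)"
    using mass by (simp add: sum.inter_filter finite_seqs)
  also have "\<dots> = (\<Sum>y\<in>seqs n. \<Sum>x\<in>seqs n. if good (\<lambda>i. (x i, y i)) then iid Q n (\<lambda>i. (x i, y i)) else 0)"
    unfolding sum_seqs_pair[symmetric] by (intro sum.cong if_cong agree[symmetric]) auto
  also have "\<dots> = (\<Sum>y\<in>seqs n. \<Sum>x\<in>T y. iid Q n (\<lambda>i. (x i, y i)))"
    by (simp add: T_def sum.inter_filter finite_seqs)
  finally have "1 / 2 * exp (- real n * (DXY Q + e)) \<le>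
      (\<Sum>y\<in>seqs n. \<Sum>x\<in>T y. iid Q n (\<lambda>i. (x i, y i))) * exp (- real n * (DXY Q + e))"
    by (intro mult_right_mono) auto
  also have "\<dots> \<le> (\<Sum>y\<in>seqs n. A y)"
    unfolding A_def sum_distrib_right by (intro sum_mono typical)
  finally have sumA: "1 / 2 * exp (- real n * (DXY Q + e)) \<le> (\<Sum>y\<in>seqs n. A y)" .

  have K: "0 < K" by (simp add: K_def)
  have "3 / (8 * sqrt 7) * exp (- real n * (DXY Q + 1 / 2 * max 0 (R - DX Q) + 3 / 2 * e)) =
      3 / 4 / K * (1 / 2 * exp (- real n * (DXY Q + e)))"
  proof -
    have "exp (- real n * (DXY Q + 1 / 2 * max 0 (R - DX Q) + 3 / 2 * e)) =
        exp (- real n * (DXY Q + e)) / exp (n * (max 0 (R - DX Q) + e) / 2)"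
      by (simp add: algebra_simps add_divide_distrib flip: exp_diff)
    then show ?thesis by (simp add: K_def)
  qed
  also have "\<dots> \<le> 3 / 4 / K * (\<Sum>y\<in>seqs n. A y)"
    using sumA K by (intro mult_left_mono) auto
  also have "\<dots> = 1 / M * (\<Sum>y\<in>seqs n. 3 / 4 * M * A y / K)"
    using M by (simp add: sum_distrib_left)
  also have "\<dots> \<le> expected_tv P W n M"
    unfolding expected_tv_eq[OF M(1)]
  proof (intro mult_left_mono sum_mono)
    fix y :: "nat \<Rightarrow> 'y"
    have "3 / 4 * M * A y / K \<le> 3 / 4 * M * A y / sqrt (1 + 3 * (M * sum (iid P n) (T y)))"
      using A0[of y] sqrt_le[of y] iidP0 by (intro divide_left_mono) (auto intro!: mult_pos_pos K add_pos_nonneg mult_nonneg_nonneg sum_nonneg)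
    also have "\<dots> \<le> EM M (\<lambda>c. \<bar>\<Sum>j<M. mem_chan W n (c j) y - iid PY n y\<bar>)"
      unfolding A_def mean_mem_chan[symmetric]
    proof (rule iid_expect_dev_ge)
      have "4 * iid PY n y * sum (iid P n) (T y) = (\<Sum>x\<in>T y. iid P n x * (4 * iid PY n y))"
        by (simp add: sum_distrib_left sum_distrib_right mult_ac)
      also have "\<dots> \<le> (\<Sum>x\<in>T y. iid P n x * mem_chan W n x y)"
        by (intro sum_mono mult_left_mono typical iidP0)
      finally show "4 * (\<Sum>x\<in>seqs n. iid P n x * mem_chan W n x y) * sum (iid P n) (T y)
          \<le> (\<Sum>x\<in>T y. iid P n x * mem_chan W n x y)"
        by (simp add: mean_mem_chan)
    qed (auto simp: T_def mem_chan_nonneg)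
    finally show "3 / 4 * M * A y / K \<le> EM M (\<lambda>c. \<bar>\<Sum>j<M. mem_chan W n (c j) y - iid PY n y\<bar>)" .
  qed simp
  finally show ?thesis .
qed

text \<open>The Chebyshev threshold does not involve \<open>M\<close>, so one block length bound
  serves all codebook sizes.\<close>

lemma expected_tv_ge:
  fixes R :: real
  assumes l: "1 \<le> l" and nondeg: "0 < P x0" "W x0 \<noteq> PY" and e: "0 < e"
  shows "\<forall>\<^sub>F n in sequentially. \<forall>M. 0 < M \<longrightarrow> M \<le> 2 * exp (n * R) \<longrightarrow>
    3 / (8 * sqrt 7) * exp (- real n * (DXY (tilt l) + 1 / 2 * max 0 (R - DX (tilt l)) + e)) \<le> expected_tv P W n M"
proof -
  define f1 where "f1 = (\<lambda>z. ln (tilt l z / PXY z))"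
  define f2 where "f2 = (\<lambda>(x, y). ln (tilt l (x, y) / (P x * marg_Y (tilt l) y)))"
  define f3 where "f3 = (\<lambda>(x, y). ln (W x y / PY y))"
  define m3 where "m3 = (\<Sum>z\<in>UNIV. tilt l z * f3 z)"
  \<comment> \<open>The first bound turns the slack \<open>3 / 2 * d\<close> into at most
    \<open>e\<close>; the second keeps \<open>m3 - d\<close> positive, so that the likelihood ratio
    grows.\<close>
  define d where "d = min (2 / 3 * e) (m3 / 2)"
  define V where "V = (\<Sum>z\<in>UNIV. tilt l z * (f1 z - DXY (tilt l))\<^sup>2) + (\<Sum>z\<in>UNIV. tilt l z * (f2 z - DX (tilt l))\<^sup>2)
      + (\<Sum>z\<in>UNIV. tilt l z * (f3 z - m3)\<^sup>2)"
  have "0 < m3"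
    using mean_log_likelihood_pos[OF l nondeg] by (simp add: m3_def f3_def case_prod_unfold)
  then have d: "0 < d" "d < m3" "3 / 2 * d \<le> e" using e by (auto simp: d_def)
  have "(\<lambda>n. V / (real n * d\<^sup>2)) \<longlonglongrightarrow> 0"
    using lim_const_over_n[of "V / d\<^sup>2"] by (simp add: mult.commute)
  then have "\<forall>\<^sub>F n in sequentially. V / (real n * d\<^sup>2) < 1 / 2"
    by (rule order_tendstoD) simp
  moreover have "filterlim (\<lambda>n. real n * (m3 - d)) at_top sequentially"
    using d by (intro filterlim_at_top_mult_tendsto_pos[OF tendsto_const] filterlim_real_sequentially) auto
  then have "\<forall>\<^sub>F n in sequentially. ln 4 \<le> real n * (m3 - d)"
    unfolding filterlim_at_top by blast
  ultimately show ?thesis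
    using eventually_gt_at_top[of 0]
  proof eventually_elim
    case (elim n)
    show ?case
    proof (intro allI impI)
      fix M :: nat assume M: "0 < M" "M \<le> 2 * exp (n * R)"
      have "3 / (8 * sqrt 7) * exp (- real n * (DXY (tilt l) + 1 / 2 * max 0 (R - DX (tilt l)) + e)) \<le>
          3 / (8 * sqrt 7) * exp (- real n * (DXY (tilt l) + 1 / 2 * max 0 (R - DX (tilt l)) + 3 / 2 * d))"
        using d by (intro mult_left_mono) (auto intro!: mult_left_mono)
      also have "\<dots> \<le> expected_tv P W n M"
        using elim M d unfolding V_def m3_def f1_def f2_def f3_def
        by (intro expected_tv_ge_typical) auto
      finally show "3 / (8 * sqrt 7) * exp (- real n * (DXY (tilt l) + 1 / 2 * max 0 (R - DX (tilt l)) + e)) \<le> expected_tv P W n M" .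
    qed
  qed
qed

end

text \<open>Constant factors cost \<open>ln C / n\<close> and \<open>ln c / n\<close>, which vanish;
  the lower bound also makes \<open>a n\<close> positive eventually, so that its logarithm is
  meaningful.\<close>

lemma exponent_tendsto:
  fixes a :: "nat \<Rightarrow> real"
  assumes c: "0 < c" "0 < C"
    and le: "\<And>n. a n \<le> C * exp (- real n * L)"
    and ge: "\<And>e. 0 < e \<Longrightarrow> \<forall>\<^sub>F n in sequentially. c * exp (- real n * (L + e)) \<le> a n"
  shows "(\<lambda>n. - (1 / n) * ln (a n)) \<longlonglongrightarrow> L"
proof (rule tendstoI)
  fix e :: real assume e: "0 < e"
  have "\<forall>\<^sub>F n in sequentially. ln C / real n < e" "\<forall>\<^sub>F n in sequentially. - ln c / real n < e / 2"
    by (rule order_tendstoD(2)[OF lim_const_over_n], use e in simp)+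
  moreover have "\<forall>\<^sub>F n in sequentially. c * exp (- real n * (L + e / 2)) \<le> a n" using e by (intro ge) simp
  ultimately show "\<forall>\<^sub>F n in sequentially. dist (- (1 / n) * ln (a n)) L < e"
    using eventually_gt_at_top[of 0]
  proof eventually_elim
    case (elim n)
    have a: "0 < a n" using elim(3) c by (smt (verit) exp_gt_zero mult_pos_pos)
    have "ln (a n) \<le> ln (C * exp (- real n * L))" using a le c by (subst ln_le_cancel_iff) auto
    then have up: "ln (a n) \<le> ln C - n * L" using c by (simp add: ln_mult)
    have "ln (c * exp (- real n * (L + e / 2))) \<le> ln (a n)" using a elim(3) c by (subst ln_le_cancel_iff) auto
    then have lo: "ln c - n * (L + e / 2) \<le> ln (a n)" using c by (simp add: ln_mult)
    have "L - ln C / n \<le> - (1 / n) * ln (a n)"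
      using divide_right_mono[OF up, of n] elim(4) by (simp add: diff_divide_distrib)
    moreover have "- (1 / n) * ln (a n) \<le> L + e / 2 + - ln c / n"
      using divide_right_mono[OF lo, of n] elim(4) by (simp add: diff_divide_distrib)
    ultimately show ?case using elim(1,2) unfolding dist_real_def by linarith
  qed
qed

section \<open>The exponent\<close>

context dmc
begin

lemma soft_cov_obj_eq:
  assumes Q: "is_pmf Q" and ac: "\<And>x y. 0 < Q (x, y) \<Longrightarrow> 0 < P x \<and> 0 < W x y"
  shows "soft_cov_obj b R P W Q = ereal (DXY Q / ln b + 1 / 2 * max 0 (R - DX Q / ln b))"
proof -
  have "rel_ent b Q PXY = ereal (DXY Q / ln b)"
    unfolding DXY_def using Q by (rule rel_ent_eq_KL) (use ac in \<open>force simp: joint_def\<close>)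
  moreover have "rel_ent b Q (\<lambda>(x, y). P x * marg_Y Q y) = ereal (DX Q / ln b)"
    unfolding DX_def using Q by (rule rel_ent_eq_KL) (use ac marg_pos[OF Q] in force)
  ultimately show ?thesis
    by (simp add: soft_cov_obj_def zero_ereal_def flip: ereal_max)
qed

text \<open>The first divergence is infinite, and the positive part is at least 0 even if its own
  divergence is infinite, so nothing cancels.\<close>

lemma soft_cov_obj_infinite:
  assumes "is_pmf Q" "0 < Q (x, y)" "\<not> (0 < P x \<and> 0 < W x y)"
  shows "soft_cov_obj b R P W Q = \<infinity>"
proof -
  have "PXY (x, y) = 0"
    using assms(3) P_nonneg[of x] W_nonneg[of x y] by (auto simp: joint_def order_le_less)
  then have "rel_ent b Q PXY = \<infinity>"
    using assms(2) by (auto simp: rel_ent_def)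
  then show ?thesis by (simp add: soft_cov_obj_def)
qed

text \<open>Weak duality: for orders in \<open>{1..2}\<close> the coefficient
  \<open>1 - 1 / l\<close> lies between 0 and 1/2, so its product with a real is at most half the
  positive part.\<close>

lemma soft_cov_obj_ge:
  assumes Q: "is_pmf Q" and b: "1 < b" and l: "l \<in> {1..2}"
  shows "ereal (((1 - 1 / l) * (R * ln b) - ln (Z l)) / ln b) \<le> soft_cov_obj b R P W Q"
proof (cases "\<forall>x y. 0 < Q (x, y) \<longrightarrow> 0 < P x \<and> 0 < W x y")
  case True
  have "(1 - 1 / l) * (R * ln b) - ln (Z l) \<le> DXY Q + (1 - 1 / l) * (R * ln b - DX Q)"
    using variational_ge[OF Q, of l] True l by (simp add: algebra_simps)
  also have "\<dots> \<le> DXY Q + 1 / 2 * max 0 (R * ln b - DX Q)"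
  proof -
    have s: "0 \<le> 1 - 1 / l" "1 - 1 / l \<le> 1 / 2" using l by (auto simp: field_simps)
    have "(1 - 1 / l) * (R * ln b - DX Q) \<le> (1 - 1 / l) * max 0 (R * ln b - DX Q)"
      using s by (intro mult_left_mono) auto
    also have "\<dots> \<le> 1 / 2 * max 0 (R * ln b - DX Q)"
      using s by (intro mult_right_mono) auto
    finally show ?thesis by simp
  qed
  finally have "((1 - 1 / l) * (R * ln b) - ln (Z l)) / ln b \<le>
      (DXY Q + 1 / 2 * max 0 (R * ln b - DX Q)) / ln b"
    using b by (intro divide_right_mono) auto
  also have "\<dots> = DXY Q / ln b + 1 / 2 * max 0 (R - DX Q / ln b)"
    using b by (simp add: max_def field_simps)
  finally show ?thesis using soft_cov_obj_eq[OF Q] True by simp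
qed (use soft_cov_obj_infinite[OF Q] in force)

text \<open>At order 1, where Sibson's information is defined separately, both sides are 0 because
  \<open>Z 1 = 1\<close>.\<close>

lemma sibson_objective:
  assumes b: "1 < b" and l: "1 \<le> l"
  shows "(l - 1) / l * (R - sibson_mi b P W l) = ((1 - 1 / l) * (R * ln b) - ln (Z l)) / ln b"
proof (cases "l = 1")
  case False
  then have "(l - 1) / l * sibson_mi b P W l = ln (Z l) / ln b"
    using l by (simp add: sibson_mi_def Z_def B_def log_def)
  moreover have "(l - 1) / l = 1 - 1 / l" using l by (simp add: diff_divide_distrib)
  ultimately show ?thesis using b by (simp add: right_diff_distrib diff_divide_distrib)
qed (simp add: Z_1)

end

theorem theorem1:
  fixes b R :: real
    and P :: "'x::finite \<Rightarrow> real"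
    and W :: "'x \<Rightarrow> 'y::finite \<Rightarrow> real"
  assumes "b > 1"
    and "is_pmf P"
    and "is_channel W"
    and nondeg: "\<exists>x. P x > 0 \<and> W x \<noteq> out_dist P W"
    and "R > mutual_info b P W"
  shows "\<exists>L::real.
     (\<lambda>n. - (1 / real n) * log b (expected_tv P W n (nat \<lceil>b powr (real n * R)\<rceil>)))
        \<longlonglongrightarrow> L
   \<and> (\<exists>Q. is_pmf Q \<and> soft_cov_obj b R P W Q = ereal L)
   \<and> (\<forall>Q. is_pmf Q \<longrightarrow> ereal L \<le> soft_cov_obj b R P W Q)
   \<and> (\<exists>l\<in>{1..2}. (l - 1) / l * (R - sibson_mi b P W l) = L)
   \<and> (\<forall>l\<in>{1..2}. (l - 1) / l * (R - sibson_mi b P W l) \<le> L)"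
proof -
  interpret dmc P W using assms by unfold_locales
  have lnb: "0 < ln b" using assms by simp
  \<comment> \<open>The rate in nats; the exponent \<open>E\<close> is found in nats and divided by
    \<open>ln b\<close> at the end.\<close>
  define r where "r = R * ln b"
  have r: "DX (tilt 1) < r"
    using assms(5) lnb unfolding DX_tilt_1[of b, symmetric] by (simp add: r_def field_simps)
  have r0: "0 \<le> r"
    using r DX_nonneg[OF pmf_tilt, of 1] by (auto simp: tilt_pos_iff)
  obtain l where l: "l \<in> {1..2}"
    and max: "\<And>l'. l' \<in> {1..2} \<Longrightarrow> (1 - 1 / l') * r - ln (Z l') \<le> (1 - 1 / l) * r - ln (Z l)"
    and eq: "(1 - 1 / l) * r - ln (Z l) = DXY (tilt l) + 1 / 2 * max 0 (r - DX (tilt l))"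
    using saddle_point[OF r] by blast
  define E where "E = (1 - 1 / l) * r - ln (Z l)"
  define M where "M n = nat \<lceil>b powr (real n * R)\<rceil>" for n
  have bpow: "b powr (real n * R) = exp (n * r)" for n
    using assms(1) by (simp add: powr_def r_def)
  have M_ge: "exp (n * r) \<le> M n" for n
    unfolding M_def bpow by (rule real_nat_ceiling_ge)
  then have M_pos: "0 < M n" for n
    by (metis exp_gt_zero less_le_trans of_nat_0_less_iff)
  have M_le: "M n \<le> 2 * exp (n * r)" for n
  proof -
    have "0 \<le> \<lceil>exp (n * r)\<rceil>" using exp_gt_zero[of "n * r"] by linarith
    then have "M n \<le> exp (n * r) + 1"
      using of_int_ceiling_le_add_one[of "exp (n * r)"] by (simp add: M_def bpow)
    moreover have "1 \<le> exp (n * r)" using r0 by simp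
    ultimately show ?thesis by linarith
  qed
  \<comment> \<open>The same order \<open>l\<close> serves both sides: the moment bound of order
    \<open>l\<close> gives \<open>E\<close> directly, and typicality under \<open>tilt l\<close>
    gives it through the identity \<open>eq\<close>.\<close>
  have "(\<lambda>n. - (1 / n) * ln (expected_tv P W n (M n))) \<longlonglongrightarrow> E"
  proof (rule exponent_tendsto)
    show "expected_tv P W n (M n) \<le> 3 * exp (- real n * E)" for n
      unfolding E_def using l M_ge by (intro expected_tv_le) auto
    show "\<forall>\<^sub>F n in sequentially. 3 / (8 * sqrt 7) * exp (- real n * (E + e)) \<le> expected_tv P W n (M n)"
      if "0 < e" for e
    proof -
      obtain x where "0 < P x" "W x \<noteq> PY" using nondeg by auto
      with l that have "\<forall>\<^sub>F n in sequentially. \<forall>M. 0 < M \<longrightarrow> M \<le> 2 * exp (n * r) \<longrightarrow>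
          3 / (8 * sqrt 7) * exp (- real n * (E + e)) \<le> expected_tv P W n M"
        unfolding E_def eq by (intro expected_tv_ge) auto
      then show ?thesis by eventually_elim (use M_pos M_le in auto)
    qed
  qed auto
  then have "(\<lambda>n. - (1 / n) * ln (expected_tv P W n (M n)) / ln b) \<longlonglongrightarrow> E / ln b"
    using lnb by (intro tendsto_divide tendsto_const) auto
  then have "(\<lambda>n. - (1 / real n) * log b (expected_tv P W n (M n))) \<longlonglongrightarrow> E / ln b"
    by (simp add: log_def)
  moreover have "soft_cov_obj b R P W (tilt l) = ereal (E / ln b)"
  proof -
    have "soft_cov_obj b R P W (tilt l) =
        ereal (DXY (tilt l) / ln b + 1 / 2 * max 0 (R - DX (tilt l) / ln b))"
      by (rule soft_cov_obj_eq[OF pmf_tilt]) (simp add: tilt_pos_iff)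
    also have "DXY (tilt l) / ln b + 1 / 2 * max 0 (R - DX (tilt l) / ln b) = E / ln b"
      unfolding E_def eq using lnb by (simp add: max_def r_def field_simps)
    finally show ?thesis .
  qed
  moreover have "ereal (E / ln b) \<le> soft_cov_obj b R P W Q" if "is_pmf Q" for Q
    unfolding E_def r_def using that assms(1) l by (rule soft_cov_obj_ge)
  moreover have "(l' - 1) / l' * (R - sibson_mi b P W l') \<le> E / ln b" if "l' \<in> {1..2}" for l'
    using max[OF that] that lnb sibson_objective[OF assms(1), of l' R]
    by (simp add: E_def r_def divide_right_mono)
  moreover have "(l - 1) / l * (R - sibson_mi b P W l) = E / ln b"
    using l sibson_objective[OF assms(1), of l R] by (simp add: E_def r_def)
  ultimately show ?thesis
    unfolding M_def using l pmf_tilt by (intro exI[of _ "E / ln b"]) blast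
qed

end
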